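(* For every positive integer $n$, the average size of a $(2n+1,2n+3)$-core partition with distinct parts (the average being taken uniformly over the finite set of all such partitions) is $$ \frac{1}{32}\left( 10n^{3}+27n^{2}+19n \right). $$
   Context: A partition is a non-increasing finite sequence $\lambda=(\lambda_1,\dots,\lambda_k)$, $k\ge 0$, of positive integers (the empty partition is allowed); its size is $\lambda_1+\dots+\lambda_k$, and it has distinct parts if the $\lambda_i$ are pairwise distinct. The hook length of a cell $(i,j)$, $1\le j\le\lambda_i$, of its Ferrers (Young) diagram is $\lambda_i-i+\lambda'_j-j+1$, where $\lambda'$ is the conjugate partition. A partition is an $(s,t)$-core partition if none of its hook lengths equals $s$ and none equals $t$. For $s=2n+1$, $t=2n+3$ (relatively prime) the set of $(s,t)$-core partitions is finite. *)

theory Defs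
  imports Complex_Main
begin

definition is_partition :: "nat list \<Rightarrow> bool" where
  "is_partition p \<longleftrightarrow> sorted_wrt (\<ge>) p \<and> (\<forall>x\<in>set p. 0 < x)"

definition part :: "nat list \<Rightarrow> nat \<Rightarrow> nat" where
  "part p i = p ! (i - 1)"  \<comment> \<open>parts are numbered from 1, as in the usual notation for cells\<close>

definition conj_part :: "nat list \<Rightarrow> nat \<Rightarrow> nat" where
  "conj_part p j = card {i \<in> {1..length p}. j \<le> part p i}"

definition cells :: "nat list \<Rightarrow> (nat \<times> nat) set" where
  "cells p = {(i, j). i \<in> {1..length p} \<and> j \<in> {1..part p i}}"

text \<open>Integer-valued to avoid truncated subtraction: a difference such as part p i - i
  may be negative at a cell, although the hook length itself is positive.\<close>
definition hook_length :: "nat list \<Rightarrow> nat \<Rightarrow> nat \<Rightarrow> int" where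
  "hook_length p i j = int (part p i) - int i + int (conj_part p j) - int j + 1"

definition is_core :: "nat \<Rightarrow> nat \<Rightarrow> nat list \<Rightarrow> bool" where
  "is_core s t p \<longleftrightarrow> is_partition p \<and>
     (\<forall>(i, j) \<in> cells p. hook_length p i j \<noteq> int s \<and> hook_length p i j \<noteq> int t)"

definition distinct_cores :: "nat \<Rightarrow> nat \<Rightarrow> nat list set" where
  "distinct_cores s t = {p. is_core s t p \<and> distinct p}"

definition average_size :: "nat list set \<Rightarrow> real" where
  "average_size C = (\<Sum>p\<in>C. real (sum_list p)) / real (card C)"

end

theory Submission
  imports Defs
begin

text \<open>
  A partition is encoded by its beads, the hook lengths of its first column. It is an
  \<open>(s, t)\<close>-core iff the set of beads is closed under subtracting \<open>s\<close> and \<open>t\<close> within the natural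
  numbers (\<open>is_core_iff_beads\<close>), it has distinct parts iff no two beads are consecutive, and its
  size is the sum of the beads minus \<open>k(k-1)/2\<close> for \<open>k\<close> beads.

  For \<open>s = 2n+1\<close> and \<open>t = 2n+3\<close> write the numbers into \<open>2n+2 = (s+t)/2\<close> columns, so that
  subtracting \<open>s\<close> or \<open>t\<close> leads one level down into the neighbouring column on the left or on the
  right. Closed sets without consecutive elements are then the regions below a mountain outline
  \<open>b\<^sub>0, \<dots>, b\<^sub>2\<^sub>n\<^sub>+\<^sub>1\<close> whose neighbouring heights differ by one or are both zero and that starts and
  ends at the same height \<open>a\<close> (\<open>bead_set_below\<close>, \<open>below_inject\<close>, \<open>ex_profile\<close>). Such an outline is
  a folded walk with steps \<open>\<plusminus>1\<close> from \<open>a\<close> to \<open>-a-1\<close>: pairs of zeros are the crossings of the axis.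
  The steps form a list of \<open>2n+1\<close> signs with negative sum \<open>-2a-1\<close>, and every such list occurs once
  (\<open>bij_betw_signs_bead_sets\<close>). In particular there are \<open>4\<^sup>n\<close> cores.

  In terms of \<open>m\<^sub>i\<close>, the sum of the signs before position \<open>i\<close> minus the sum of those after it, the
  size of the core is the quadratic expression \<open>size_form\<close>: a combination of \<open>\<Sum>m\<^sub>i\<^sup>2\<close>, of
  \<open>(\<Sum>\<bar>m\<^sub>i\<bar>)\<^sup>2\<close>, of \<open>\<Sum>\<bar>m\<^sub>i\<bar> (i - n)\<close> and of the squared sum of all signs (\<open>size_below\<close>,
  \<open>size_form_eq\<close>). It is even, so the average may be taken over all lists of \<open>2n+1\<close> independent fair
  signs. There the third term vanishes by symmetry and the squares are variances. What remains is
  the mean of \<open>\<bar>m\<^sub>i\<bar> \<bar>m\<^sub>j\<bar>\<close>. For \<open>i < j\<close> it equals the mean of \<open>\<bar>X\<^sup>2 - Y\<^sup>2\<bar>\<close> for two independent random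
  walks with \<open>p = j - i - 1\<close> and \<open>2n - 1 - p\<close> steps (\<open>sum_mid_mid_less\<close>). As a function of \<open>p\<close> this mean
  has the second differences \<open>2 u\<^sub>i u\<^sub>m\<^sub>-\<^sub>i\<close> with \<open>m = n - 1\<close>, where \<open>u\<^sub>i\<close> is the probability that a walk
  of \<open>2i\<close> steps returns to its start. The identities \<open>\<Sum> u\<^sub>i u\<^sub>m\<^sub>-\<^sub>i = 1\<close> and
  \<open>\<Sum> i(m-i) u\<^sub>i u\<^sub>m\<^sub>-\<^sub>i = m(m-1)/8\<close> then give the total \<open>n(3n-1)\<close> over all \<open>p\<close> (\<open>sum_gap_mean\<close>), and
  the stated polynomial follows.
\<close>

section \<open>Partitions and their beads\<close>

text \<open>These are the hook lengths of the first column, \<open>p\<^sub>i + k - i\<close> for a partition with \<open>k\<close>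
parts: prepending a part leaves the other hooks of the first column unchanged.\<close>

fun beads :: "nat list \<Rightarrow> nat set" where
  "beads [] = {}"
| "beads (x # p) = insert (x + length p) (beads p)"

lemma is_partition_Cons:
  "is_partition (x # p) \<longleftrightarrow> 0 < x \<and> is_partition p \<and> (\<forall>y\<in>set p. y \<le> x)"
  by (auto simp: is_partition_def)

lemma finite_beads [simp]: "finite (beads p)"
  by (induction p) auto

lemma beads_eq_image: "beads p = (\<lambda>i. p ! i + (length p - Suc i)) ` {..<length p}"
  by (induction p) (auto simp: lessThan_Suc_eq_insert_0 image_image)

lemma beads_less:
  assumes "is_partition p" "\<forall>y\<in>set p. y \<le> x" "z \<in> beads p"
  shows "z < x + length p"
proof -
  from assms(3) obtain i where "i < length p" "z = p ! i + (length p - Suc i)"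
    by (auto simp: beads_eq_image)
  moreover from this assms(2) have "p ! i \<le> x" by auto
  ultimately show ?thesis by linarith
qed

lemma new_bead: "is_partition (x # p) \<Longrightarrow> x + length p \<notin> beads p"
  using beads_less[of p x] by (auto simp: is_partition_Cons)

lemma card_beads: "is_partition p \<Longrightarrow> card (beads p) = length p"
  by (induction p) (auto simp: new_bead is_partition_Cons)

lemma zero_notin_beads: "is_partition p \<Longrightarrow> 0 \<notin> beads p"
  by (induction p) (auto simp: is_partition_Cons)

lemma sum_beads:
  assumes "is_partition p"
  shows "2 * int (\<Sum>(beads p)) = 2 * int (sum_list p) + int (length p) * (int (length p) - 1)"
  using assms
proof (induction p)
  case (Cons x p)
  have "\<Sum>(beads (x # p)) = x + length p + \<Sum>(beads p)"
    using new_bead[OF Cons.prems] by simp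
  with Cons show ?case by (simp add: is_partition_Cons algebra_simps)
qed simp

text \<open>Two neighbouring parts are equal exactly if their beads are consecutive numbers.\<close>

lemma distinct_iff_beads:
  assumes "is_partition p"
  shows "distinct p \<longleftrightarrow> (\<forall>x\<in>beads p. Suc x \<notin> beads p)"
  using assms
proof (induction p)
  case (Cons x p)
  have p: "is_partition p" and le: "\<forall>y\<in>set p. y \<le> x" and "0 < x"
    using Cons.prems by (auto simp: is_partition_Cons)
  have less: "z < x + length p" if "z \<in> beads p" for z
    using beads_less[OF p le that] .
  have "x \<in> set p \<longleftrightarrow> (\<exists>z\<in>beads p. Suc z = x + length p)"
  proof
    assume "x \<in> set p"
    \<comment> \<open>the first part is the largest one, so it equals \<open>x\<close>\<close>
    then obtain y q where pq: "p = y # q" by (cases p) auto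
    with \<open>x \<in> set p\<close> le p have "y = x" by (auto simp: is_partition_Cons)
    with pq show "\<exists>z\<in>beads p. Suc z = x + length p" by auto
  next
    assume "\<exists>z\<in>beads p. Suc z = x + length p"
    then obtain i where i: "i < length p" "Suc (p ! i + (length p - Suc i)) = x + length p"
      by (auto simp: beads_eq_image)
    from i(1) le have "p ! i \<le> x" by auto
    with i have "p ! i = x" by linarith
    with i(1) show "x \<in> set p" by auto
  qed
  with Cons.IH[OF p] less show ?case by fastforce
qed simp

lemma beads_inject:
  assumes "is_partition p" "is_partition q" "beads p = beads q"
  shows "p = q"
  using assms
proof (induction p arbitrary: q)
  case Nil
  then show ?case by (cases q) auto
next
  case (Cons x p)
  then obtain y r where q: "q = y # r" by (cases q) auto
  have len: "length p = length r"
    using card_beads[OF Cons.prems(1)] card_beads[OF Cons.prems(2)] Cons.prems(3) q by auto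
  have mx: "x + length p = Max (beads (x # p))" if "is_partition (x # p)" for x p
    using that beads_less[of p x]
    by (intro Max_eqI[symmetric]) (auto simp: is_partition_Cons less_imp_le)
  have "x + length p = y + length r"
    using mx[OF Cons.prems(1)] mx[of y r] Cons.prems(2,3) q by auto
  with len have "x = y" by simp
  moreover have "beads p = beads r"
    using Cons.prems q new_bead[of x p] new_bead[of y r] \<open>x = y\<close> len
    by (auto simp: insert_ident)
  ultimately show ?case
    using Cons q by (auto simp: is_partition_Cons)
qed

lemma ex_partition_beads:
  assumes "finite B" "0 \<notin> B"
  shows "\<exists>p. is_partition p \<and> beads p = B"
  using assms
proof (induction B rule: finite_linorder_max_induct)
  case empty
  have "is_partition []" by (simp add: is_partition_def)
  then show ?case by force
next
  case (insert b A)
  then obtain p where p: "is_partition p" "beads p = A" by auto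
  have len: "length p = card A" using card_beads[OF p(1)] p(2) by simp
  have "A \<subseteq> {0<..<b}" using insert by (auto intro: gr0I)
  then have "card A \<le> card {0<..<b}" by (intro card_mono) auto
  with insert have lt: "card A < b" by (cases b) auto
  have "y \<le> b - card A" if y: "y \<in> set p" for y
  proof -
    obtain x q where pq: "p = x # q" using y by (cases p) auto
    have "y \<le> x" using p(1) y unfolding pq by (auto simp: is_partition_Cons)
    moreover have "x + length q < b" using insert.hyps p(2) pq by auto
    ultimately show ?thesis using len pq by simp
  qed
  then have "is_partition ((b - card A) # p)"
    using p(1) lt by (auto simp: is_partition_Cons)
  moreover have "beads ((b - card A) # p) = insert b A"
    using p lt len by simp
  ultimately show ?case by blast
qed

text \<open>The cells of a row with bead \<open>x\<close> correspond to the gaps below \<open>x\<close>, the numbers that are not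
beads: column \<open>j\<close> belongs to the gap \<open>y j\<close>, which is \<open>j - 1\<close> plus the number of parts smaller
than \<open>j\<close>, and the hook length is \<open>x - y j\<close>. The map \<open>y\<close> is strictly increasing, so it suffices
to count: below \<open>x\<close> there are as many gaps as cells in the row.\<close>

lemma hook_lengths_of_row:
  assumes p: "is_partition p" and i: "i \<in> {1..length p}"
  defines "x \<equiv> part p i + (length p - i)"
  shows "hook_length p i ` {1..part p i} = (\<lambda>y. int x - int y) ` ({..<x} - beads p)"
proof -
  define k where "k = length p"
  define y where "y = (\<lambda>j. j - 1 + (k - conj_part p j))"
  have mono: "part p m' \<le> part p m" if "1 \<le> m" "m \<le> m'" "m' \<le> k" for m m'
  proof (cases "m = m'")
    case False
    with that have "m - 1 < m' - 1" "m' - 1 < length p" by (auto simp: k_def)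
    with p show ?thesis
      using sorted_wrt_nth_less[of "(\<ge>)" p] unfolding is_partition_def part_def by blast
  qed simp
  have conj_le: "conj_part p j \<le> k" for j
    unfolding conj_part_def k_def
    by (rule order.trans[OF card_mono[of "{1..length p}"]]) auto
  have conj_ge: "m \<le> conj_part p j" if "1 \<le> m" "m \<le> k" "j \<le> part p m" for m j
  proof -
    have "{1..m} \<subseteq> {i \<in> {1..length p}. j \<le> part p i}"
      using that mono[of _ m] by (force simp: k_def)
    from card_mono[OF _ this] show ?thesis by (simp add: conj_part_def)
  qed
  have conj_less: "conj_part p j < m" if "1 \<le> m" "m \<le> k" "part p m < j" for m j
  proof -
    have "{i \<in> {1..length p}. j \<le> part p i} \<subseteq> {1..<m}"
    proof clarify
      fix l assume "l \<in> {1..length p}" "j \<le> part p l"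
      with mono[of m l] that show "l \<in> {1..<m}" by (cases "m \<le> l") (auto simp: k_def)
    qed
    from card_mono[OF _ this] that show ?thesis by (simp add: conj_part_def)
  qed
  have beads: "beads p = (\<lambda>m. part p m + (k - m)) ` {1..k}"
  proof -
    have "{1..k} = Suc ` {..<k}" by (metis atLeast0LessThan atLeastLessThanSuc_atLeastAtMost image_Suc_atLeastLessThan One_nat_def)
    then show ?thesis by (simp add: beads_eq_image part_def k_def image_image)
  qed
  have i': "1 \<le> i" "i \<le> k" using i by (auto simp: k_def)
  have y_less: "y j < x" if "j \<in> {1..part p i}" for j
    using conj_ge[of i j] that i' by (auto simp: y_def x_def k_def[symmetric])
  have y_notin: "y j \<notin> beads p" if "j \<ge> 1" for j
  proof
    assume "y j \<in> beads p"
    then obtain m where m: "1 \<le> m" "m \<le> k" "y j = part p m + (k - m)"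
      by (auto simp: beads)
    show False
    proof (cases "j \<le> part p m")
      case True
      with conj_ge[of m j] m that show False by (simp add: y_def)
    next
      case False
      with conj_less[of m j] m that show False by (simp add: y_def)
    qed
  qed
  have y_mono: "y j < y j'" if "1 \<le> j" "j < j'" for j j'
  proof -
    have "conj_part p j' \<le> conj_part p j"
      unfolding conj_part_def using that by (intro card_mono) auto
    with that show ?thesis by (simp add: y_def)
  qed
  have inj: "inj_on y {1..part p i}"
    using y_mono by (intro linorder_inj_onI') fastforce+
  have sub: "y ` {1..part p i} \<subseteq> {..<x} - beads p"
    using y_less y_notin by auto
  have card_below: "card ({..<x} \<inter> beads p) = k - i"
  proof -
    have "{..<x} \<inter> beads p = (\<lambda>m. part p m + (k - m)) ` {i<..k}"
    proof (intro equalityI subsetI)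
      fix z assume "z \<in> {..<x} \<inter> beads p"
      then obtain m where m: "1 \<le> m" "m \<le> k" "z = part p m + (k - m)" "z < x"
        by (auto simp: beads)
      have "i < m"
      proof (rule ccontr)
        assume "\<not> i < m"
        with mono[of m i] m i' show False by (simp add: x_def k_def[symmetric])
      qed
      with m show "z \<in> (\<lambda>m. part p m + (k - m)) ` {i<..k}" by auto
    next
      fix z assume "z \<in> (\<lambda>m. part p m + (k - m)) ` {i<..k}"
      then obtain m where m: "i < m" "m \<le> k" "z = part p m + (k - m)" by auto
      with mono[of i m] i' have "z < x" by (simp add: x_def k_def[symmetric])
      with m i' show "z \<in> {..<x} \<inter> beads p" by (auto simp: beads)
    qed
    moreover have "inj_on (\<lambda>m. part p m + (k - m)) {i<..k}"
    proof (rule linorder_inj_onI')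
      fix m m' assume *: "m \<in> {i<..k}" "m' \<in> {i<..k}" "m < m'"
      with mono[of m m'] i' show "part p m + (k - m) \<noteq> part p m' + (k - m')" by auto
    qed
    ultimately show ?thesis by (metis card_image card_greaterThanAtMost)
  qed
  have "card ({..<x} - beads p) = x - (k - i)"
    using card_below by (simp add: card_Diff_subset_Int)
  also have "\<dots> = part p i" by (simp add: x_def k_def)
  also have "\<dots> = card (y ` {1..part p i})" using inj by (simp add: card_image)
  finally have "y ` {1..part p i} = {..<x} - beads p"
    using card_subset_eq[OF _ sub] by simp
  then have "(\<lambda>y. int x - int y) ` ({..<x} - beads p) = (\<lambda>j. int x - int (y j)) ` {1..part p i}"
    by (metis image_image)
  also have "\<dots> = hook_length p i ` {1..part p i}"
  proof (rule image_cong)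
    fix j assume "j \<in> {1..part p i}"
    with i' conj_le[of j] show "int x - int (y j) = hook_length p i j"
      unfolding hook_length_def x_def y_def k_def[symmetric] by (auto simp: of_nat_diff)
  qed simp
  finally show ?thesis ..
qed

text \<open>A hook of length \<open>u\<close> in the row of the bead \<open>x\<close> means that \<open>x - u\<close> is a gap; so avoiding the
hook length \<open>u\<close> means that the beads are closed under subtracting \<open>u\<close>.\<close>

lemma is_core_iff_beads:
  assumes "0 < s" "0 < t"
  shows "is_core s t p \<longleftrightarrow> is_partition p \<and>
    (\<forall>x\<in>beads p. (s \<le> x \<longrightarrow> x - s \<in> beads p) \<and> (t \<le> x \<longrightarrow> x - t \<in> beads p))"
proof -
  define X where "X i = part p i + (length p - i)" for i
  have beads: "beads p = X ` {1..length p}"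
  proof -
    have "{1..length p} = Suc ` {..<length p}" by (metis atLeast0LessThan atLeastLessThanSuc_atLeastAtMost image_Suc_atLeastLessThan One_nat_def)
    then show ?thesis by (simp add: beads_eq_image part_def X_def image_image)
  qed
  have avoid: "int u \<notin> hook_length p i ` {1..part p i} \<longleftrightarrow> (u \<le> X i \<longrightarrow> X i - u \<in> beads p)"
    if "is_partition p" "i \<in> {1..length p}" "0 < u" for u i
  proof -
    have "int u \<in> (\<lambda>y. int (X i) - int y) ` ({..<X i} - beads p) \<longleftrightarrow> u \<le> X i \<and> X i - u \<notin> beads p"
    proof
      assume "int u \<in> (\<lambda>y. int (X i) - int y) ` ({..<X i} - beads p)"
      then obtain y where "y < X i" "y \<notin> beads p" "int u = int (X i) - int y" by auto
      moreover from this have "y = X i - u" by linarith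
      ultimately show "u \<le> X i \<and> X i - u \<notin> beads p" by auto
    next
      assume "u \<le> X i \<and> X i - u \<notin> beads p"
      then show "int u \<in> (\<lambda>y. int (X i) - int y) ` ({..<X i} - beads p)"
        using \<open>0 < u\<close> by (intro image_eqI[of _ _ "X i - u"]) auto
    qed
    with hook_lengths_of_row[OF that(1,2)] show ?thesis by (auto simp: X_def)
  qed
  have img: "int u \<notin> h ` J \<longleftrightarrow> (\<forall>j\<in>J. h j \<noteq> int u)" for u J and h :: "nat \<Rightarrow> int"
    by force
  have "is_core s t p \<longleftrightarrow> is_partition p \<and> (\<forall>i\<in>{1..length p}.
      int s \<notin> hook_length p i ` {1..part p i} \<and> int t \<notin> hook_length p i ` {1..part p i})"
    unfolding is_core_def cells_def img by blast
  also have "\<dots> \<longleftrightarrow> is_partition p \<and> (\<forall>i\<in>{1..length p}.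
      (s \<le> X i \<longrightarrow> X i - s \<in> beads p) \<and> (t \<le> X i \<longrightarrow> X i - t \<in> beads p))"
    using assms by (intro conj_cong ball_cong refl) (rule avoid; simp)+
  finally show ?thesis by (auto simp: beads)
qed

section \<open>Bead sets and mountain outlines\<close>

text \<open>The bead sets of the \<open>(2n+1, 2n+3)\<close>-cores with distinct parts.\<close>

definition bead_set :: "nat \<Rightarrow> nat set \<Rightarrow> bool" where
  "bead_set n B \<longleftrightarrow> finite B \<and> 0 \<notin> B \<and> (\<forall>x\<in>B. Suc x \<notin> B) \<and>
     (\<forall>x\<in>B. (2 * n + 1 \<le> x \<longrightarrow> x - (2 * n + 1) \<in> B) \<and> (2 * n + 3 \<le> x \<longrightarrow> x - (2 * n + 3) \<in> B))"

text \<open>The integers are written into columns \<open>0, \<dots>, 2n+1\<close>. Since \<open>2n+2\<close> is the mean of the two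
hook lengths, subtracting \<open>2n+3\<close> (or \<open>2n+1\<close>) leads one level down in the column to the right
(or to the left), so that closed sets become mountains. At the border, subtracting \<open>2n+3\<close> leads
from column \<open>2n+1\<close> to column \<open>0\<close> two levels lower, and subtracting \<open>2n+1\<close> leads from column \<open>0\<close>
to column \<open>2n+1\<close> at the same level. The offset \<open>a\<close> puts
\<open>a(2n+3) - 1\<close> at level \<open>a\<close> of column \<open>0\<close>.\<close>

definition entry :: "nat \<Rightarrow> int \<Rightarrow> nat \<Rightarrow> int \<Rightarrow> int" where
  "entry n a i l = (2 * int n + 2) * l + a - 1 - int i"

text \<open>Outlines of such mountains. The equal heights at both ends come from the border rule; two adjacent
empty columns separate mountains with opposite parity of level plus column number.\<close>

definition profile :: "nat \<Rightarrow> int \<Rightarrow> (nat \<Rightarrow> int) \<Rightarrow> bool" where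
  "profile n a b \<longleftrightarrow> 0 \<le> a \<and> a \<le> int n \<and> b 0 = a \<and> b (2 * n + 1) = a \<and> (\<forall>i\<le>2 * n + 1. 0 \<le> b i) \<and>
     (\<forall>i\<le>2 * n. \<bar>b (Suc i) - b i\<bar> = 1 \<or> b i = 0 \<and> b (Suc i) = 0)"

text \<open>A column carries beads on every other level only, counted from its summit downwards.\<close>

definition below :: "nat \<Rightarrow> int \<Rightarrow> (nat \<Rightarrow> int) \<Rightarrow> nat set" where
  "below n a b = {x. 0 < x \<and> (\<exists>i\<le>2 * n + 1. \<exists>l. 0 \<le> l \<and> l \<le> b i \<and> even (b i - l) \<and> int x = entry n a i l)}"

lemma entry_inject:
  assumes "entry n a i l = entry n a i' l'" "i \<le> 2 * n + 1" "i' \<le> 2 * n + 1"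
  shows "i = i' \<and> l = l'"
proof -
  have eq: "(2 * int n + 2) * (l - l') = int i - int i'"
    using assms(1) by (simp add: entry_def algebra_simps)
  then have "2 * int n + 2 dvd int i - int i'" by (metis dvd_triv_left)
  with dvd_imp_le_int[of "int i - int i'" "2 * int n + 2"] assms(2,3) have "int i - int i' = 0" by linarith
  with eq show ?thesis by auto
qed

lemma ex_entry: "\<exists>i\<le>2 * n + 1. \<exists>l. x = entry n a i l"
proof -
  define q where "q = (a - 1 - x) div (2 * int n + 2)"
  define r where "r = (a - 1 - x) mod (2 * int n + 2)"
  have "(2 * int n + 2) * q + r = a - 1 - x" by (simp add: q_def r_def)
  then have "x = (2 * int n + 2) * (- q) + a - 1 - r" by (simp add: algebra_simps)
  moreover have "0 \<le> r" "r < 2 * int n + 2" by (simp_all add: r_def)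
  ultimately show ?thesis
    by (intro exI[of _ "nat r"] conjI exI[of _ "- q"]) (auto simp: entry_def)
qed

lemma entry_mono: "l \<le> l' \<Longrightarrow> entry n a i l \<le> entry n a i l'"
  by (simp add: entry_def)

lemma entry_nonneg: "0 \<le> a \<Longrightarrow> i \<le> 2 * n + 1 \<Longrightarrow> 1 \<le> l \<Longrightarrow> 0 \<le> entry n a i l"
  using entry_mono[of 1 l n a i] by (simp add: entry_def)

lemma level_nonneg:
  assumes "0 \<le> entry n a i l" "a \<le> int n"
  shows "0 \<le> l"
proof (rule ccontr)
  assume "\<not> 0 \<le> l"
  with entry_mono[of l "- 1" n a i] assms show False by (simp add: entry_def)
qed

context
  fixes n :: nat and a :: int and b :: "nat \<Rightarrow> int"
  assumes profile: "profile n a b"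
begin

lemma profile_bounds: "0 \<le> a" "a \<le> int n" "b 0 = a" "b (2 * n + 1) = a" "i \<le> 2 * n + 1 \<Longrightarrow> 0 \<le> b i"
  using profile by (auto simp: profile_def)

lemma profile_step: "i \<le> 2 * n \<Longrightarrow> \<bar>b (Suc i) - b i\<bar> = 1 \<or> b i = 0 \<and> b (Suc i) = 0"
  using profile by (auto simp: profile_def)

text \<open>Until the mountain starting at height \<open>a\<close> can have reached the ground, its steps are \<open>\<plusminus>1\<close>, which
determines the parity of the heights. This range includes all columns with a positive
number at level \<open>0\<close>.\<close>

lemma profile_start:
  assumes "int i \<le> a"
  shows "a - int i \<le> b i" "even (b i - (a - int i))"
proof -
  have "a - int i \<le> b i \<and> even (b i - (a - int i))" using assms
  proof (induction i)
    case 0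
    then show ?case by (simp add: profile_bounds)
  next
    case (Suc i)
    then have IH: "a - int i \<le> b i" "even (b i - (a - int i))" by auto
    have "i \<le> 2 * n" using Suc.prems profile_bounds(2) by linarith
    from profile_step[OF this] IH Suc.prems have "b (Suc i) = b i + 1 \<or> b (Suc i) = b i - 1" by linarith
    with IH show ?case by auto
  qed
  then show "a - int i \<le> b i" "even (b i - (a - int i))" by auto
qed

text \<open>The number \<open>0\<close> stands at level \<open>0\<close> of column \<open>a - 1\<close>, which has odd height, or, if \<open>a = 0\<close>, at
level \<open>1\<close> of the empty column \<open>2n+1\<close>.\<close>

lemma entry_nonzero:
  assumes "i \<le> 2 * n + 1" "0 \<le> l" "l \<le> b i" "even (b i - l)"
  shows "entry n a i l \<noteq> 0"
proof
  assume zero: "entry n a i l = 0"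
  consider "l = 0" | "l = 1" | "2 \<le> l" using assms(2) by linarith
  then show False
  proof cases
    case 1
    with zero have "a - int i = 1" by (simp add: entry_def)
    with profile_start[of i] 1 assms(4) show False by simp
  next
    case 2
    with zero assms(1) profile_bounds(1) have "a = 0" "i = 2 * n + 1" by (auto simp: entry_def)
    with 2 assms(3) profile_bounds(4) show False by simp
  next
    case 3
    with entry_mono[OF 3, of n a i] zero assms(1) profile_bounds(1) show False by (simp add: entry_def)
  qed
qed

lemma belowI:
  assumes "i \<le> 2 * n + 1" "0 \<le> l" "l \<le> b i" "even (b i - l)" "0 \<le> entry n a i l" "int x = entry n a i l"
  shows "x \<in> below n a b"
proof -
  from entry_nonzero[OF assms(1-4)] assms(6) have "0 < x" by (cases x) auto
  with assms show ?thesis unfolding below_def by blast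
qed

text \<open>Closure holds because neighbouring summits differ by one. Consecutive numbers stand side by
side at the same level, where neighbouring columns have beads at levels of different parity
(two empty columns do not occur where level \<open>0\<close> is positive), or else at adjacent levels of the first
and the last column, whose heights are equal.\<close>

lemma bead_set_below: "bead_set n (below n a b)"
  unfolding bead_set_def
proof (intro conjI ballI impI)
  show "finite (below n a b)"
  proof (rule finite_subset)
    show "below n a b \<subseteq> (\<lambda>(i, l). nat (entry n a i l)) ` (SIGMA i:{..2 * n + 1}. {0..b i})"
    proof
      fix x assume "x \<in> below n a b"
      then obtain i l where il: "i \<le> 2 * n + 1" "0 \<le> l" "l \<le> b i" "int x = entry n a i l"
        by (auto simp: below_def)
      then have "x = (\<lambda>(i, l). nat (entry n a i l)) (i, l)" by simp
      with il show "x \<in> (\<lambda>(i, l). nat (entry n a i l)) ` (SIGMA i:{..2 * n + 1}. {0..b i})"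
        by (intro image_eqI) auto
    qed
  qed simp
  show "0 \<notin> below n a b" by (simp add: below_def)
next
  fix x assume x: "x \<in> below n a b"
  then obtain i l where il: "0 < x" "i \<le> 2 * n + 1" "0 \<le> l" "l \<le> b i" "even (b i - l)" "int x = entry n a i l"
    by (auto simp: below_def)
  note bounds = profile_bounds
  have ground: "x < 2 * n + 1" if "l = 0"
    using that il(6) bounds(2) by (simp add: entry_def)
  show "Suc x \<notin> below n a b"
  proof
    assume "Suc x \<in> below n a b"
    then obtain i' l' where il': "i' \<le> 2 * n + 1" "0 \<le> l'" "l' \<le> b i'" "even (b i' - l')" "int (Suc x) = entry n a i' l'"
      by (auto simp: below_def)
    show False
    proof (cases i)
      case 0
      then have "int (Suc x) = entry n a (2 * n + 1) (l + 1)" using il(6) by (simp add: entry_def algebra_simps)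
      with il' entry_inject[of n a i' l' "2 * n + 1" "l + 1"] have "i' = 2 * n + 1" "l' = l + 1" by auto
      with il il' 0 bounds show False by simp
    next
      case (Suc k)
      then have "int (Suc x) = entry n a k l" using il(6) by (simp add: entry_def)
      with il' entry_inject[of n a i' l' k l] Suc il(2) have eq: "i' = k" "l' = l" by auto
      have "even (b (Suc k) - b k)"
        using dvd_diff[OF il(5) il'(4)] eq Suc by simp
      then have "\<bar>b (Suc k) - b k\<bar> \<noteq> 1"
        by (metis dvd_abs_iff odd_one)
      with profile_step[of k] Suc il(2) have zero: "b k = 0" "b (Suc k) = 0" by auto
      with il(3,4) Suc have "l = 0" by simp
      with il(1,6) have "int i < a" by (simp add: entry_def)
      with profile_start(1)[of i] zero Suc show False by simp
    qed
  qed
  show "x - (2 * n + 1) \<in> below n a b" if le: "2 * n + 1 \<le> x"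
  proof (cases i)
    case 0
    then have eq: "int (x - (2 * n + 1)) = entry n a (2 * n + 1) l"
      using il(6) le by (simp add: entry_def of_nat_diff algebra_simps)
    show ?thesis by (rule belowI[OF _ _ _ _ _ eq]) (use il 0 bounds eq in auto)
  next
    case (Suc k)
    then have eq: "int (x - (2 * n + 1)) = entry n a k (l - 1)"
      using il(6) le by (simp add: entry_def of_nat_diff algebra_simps)
    have l: "1 \<le> l" using ground le il(3) by (cases "l = 0") auto
    from profile_step[of k] Suc il(2) l il(4) have "b k = b i + 1 \<or> b k = b i - 1" by auto
    with eq il Suc l show ?thesis by (intro belowI[OF _ _ _ _ _ eq]) auto
  qed
  show "x - (2 * n + 3) \<in> below n a b" if le: "2 * n + 3 \<le> x"
  proof (cases "i = 2 * n + 1")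
    case True
    then have eq: "int (x - (2 * n + 3)) = entry n a 0 (l - 2)"
      using il(6) le by (simp add: entry_def of_nat_diff algebra_simps)
    with level_nonneg[of n a 0 "l - 2"] bounds(2) have "0 \<le> l - 2" by simp
    with eq il True bounds show ?thesis by (intro belowI[OF _ _ _ _ _ eq]) auto
  next
    case False
    then have eq: "int (x - (2 * n + 3)) = entry n a (Suc i) (l - 1)"
      using il(6) le by (simp add: entry_def of_nat_diff algebra_simps)
    have l: "1 \<le> l" using ground le il(3) by (cases "l = 0") auto
    from profile_step[of i] False il(2) l il(4) have "b (Suc i) = b i + 1 \<or> b (Suc i) = b i - 1" by auto
    with eq il False l show ?thesis by (intro belowI[OF _ _ _ _ _ eq]) auto
  qed
qed

lemma top_in_below:
  assumes "i \<le> 2 * n + 1" "1 \<le> b i"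
  shows "nat (entry n a i (b i)) \<in> below n a b"
  by (rule belowI[of i "b i"]) (use assms entry_nonneg[OF profile_bounds(1) assms] in simp_all)

lemma level_le:
  assumes "nat (entry n a i l) \<in> below n a b" "i \<le> 2 * n + 1" "0 \<le> entry n a i l"
  shows "l \<le> b i"
proof -
  from assms(1) obtain i' l' where "i' \<le> 2 * n + 1" "l' \<le> b i'" "int (nat (entry n a i l)) = entry n a i' l'"
    unfolding below_def by blast
  with entry_inject[of n a i l i' l'] assms(2,3) show ?thesis by simp
qed

end

text \<open>A region determines its offset: if \<open>a < a'\<close>, then \<open>(a+1)(2n+3) - 1\<close> arises from the bead
\<open>a'(2n+3) - 1\<close> by subtracting multiples of \<open>2n+3\<close>, but in the grid of \<open>a\<close> it stands at level
\<open>a + 2\<close> of the last column, above its summit.\<close>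

lemma below_shift_le:
  assumes p: "profile n a b" and p': "profile n a' b'" and eq: "below n a b = below n a' b'"
  shows "a' \<le> a"
proof (rule ccontr)
  assume "\<not> a' \<le> a"
  then have less: "a < a'" by simp
  note bounds = profile_bounds[OF p] and bounds' = profile_bounds[OF p']
  have down: "nat (entry n a' 0 a' - int k * (2 * int n + 3)) \<in> below n a' b'" if "int k < a'" for k
    using that
  proof (induction k)
    case 0
    with top_in_below[OF p', of 0] bounds' show ?case by simp
  next
    case (Suc k)
    define y where "y = nat (entry n a' 0 a' - int k * (2 * int n + 3))"
    have "2 \<le> a' - int k" using Suc.prems by simp
    then have "2 * (2 * int n + 3) \<le> (a' - int k) * (2 * int n + 3)" by (intro mult_right_mono) auto
    moreover have y_eq: "entry n a' 0 a' - int k * (2 * int n + 3) = (a' - int k) * (2 * int n + 3) - 1"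
      by (simp add: entry_def algebra_simps)
    ultimately have y: "int y = entry n a' 0 a' - int k * (2 * int n + 3)" "2 * n + 3 \<le> y"
      unfolding y_def by auto
    moreover have "y \<in> below n a' b'" using Suc by (simp add: y_def)
    ultimately have "y - (2 * n + 3) \<in> below n a' b'"
      using bead_set_below[OF p'] by (auto simp: bead_set_def)
    moreover have "y - (2 * n + 3) = nat (entry n a' 0 a' - int (Suc k) * (2 * int n + 3))"
      using y by (simp add: algebra_simps nat_eq_iff of_nat_diff)
    ultimately show ?case by simp
  qed
  have "entry n a' 0 a' - int (nat (a' - a - 1)) * (2 * int n + 3) = entry n a (2 * n + 1) (a + 2)"
    using less by (simp add: entry_def algebra_simps)
  with down[of "nat (a' - a - 1)"] less bounds have "nat (entry n a (2 * n + 1) (a + 2)) \<in> below n a b"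
    by (simp add: eq)
  from level_le[OF p this] bounds entry_nonneg[of a "2 * n + 1" n "a + 2"] show False by simp
qed

lemma below_inject:
  assumes p: "profile n a b" and p': "profile n a' b'" and eq: "below n a b = below n a' b'"
  shows "a = a' \<and> (\<forall>i\<le>2 * n + 1. b i = b' i)"
proof -
  have a: "a = a'" using below_shift_le[OF p p' eq] below_shift_le[OF p' p eq[symmetric]] by simp
  have le: "b i \<le> b' i" if "i \<le> 2 * n + 1" "profile n a b" "profile n a b'" "below n a b = below n a b'" for b b' i
  proof (cases "1 \<le> b i")
    case True
    with top_in_below[OF that(2,1)] that entry_nonneg[OF profile_bounds(1)[OF that(2)] that(1) True] show ?thesis
      by (intro level_le[OF that(3) _ that(1)]) auto
  next
    case False
    with profile_bounds(5)[OF that(3,1)] show ?thesis by simp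
  qed
  note p'' = p'[folded a] and eq' = eq[folded a]
  show ?thesis
    using a le[OF _ p p'' eq'] le[OF _ p'' p eq'[symmetric]] by (blast intro: antisym)
qed

text \<open>The offset \<open>a\<close> is the largest number for which \<open>a(2n+3) - 1\<close> is a bead (or \<open>0\<close>), and the height
of a column is its largest bead level. Treating all negative numbers as beads makes the closure
unconditional. The decisive fact is that a bead \<open>x \<ge> 0\<close> excludes a bead \<open>x + (2n+2)\<close>, as
subtracting \<open>2n+1\<close> from the latter would give the consecutive bead \<open>x + 1\<close>. Hence the bead
levels of a column have one parity, and the column is full below its summit.\<close>

lemma ex_profile:
  assumes "bead_set n B"
  shows "\<exists>a b. profile n a b \<and> below n a b = B"
proof -
  define s t :: int where "s = 2 * int n + 1" and "t = 2 * int n + 3"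
  define H where "H x \<longleftrightarrow> x < 0 \<or> nat x \<in> B" for x :: int
  have fin: "finite B" using assms by (simp add: bead_set_def)
  have neg: "H x" if "x < 0" for x using that by (simp add: H_def)
  have zero: "\<not> H 0" using assms by (simp add: H_def bead_set_def)
  have Hs: "H (x - s)" if "H x" for x
  proof (cases "x < s")
    case False
    with that have "nat x \<in> B" "2 * n + 1 \<le> nat x" "nat (x - s) = nat x - (2 * n + 1)"
      by (auto simp: H_def s_def)
    with assms show ?thesis by (auto simp: H_def bead_set_def)
  qed (simp add: H_def)
  have Ht: "H (x - t)" if "H x" for x
  proof (cases "x < t")
    case False
    with that have "nat x \<in> B" "2 * n + 3 \<le> nat x" "nat (x - t) = nat x - (2 * n + 3)"
      by (auto simp: H_def t_def)
    with assms show ?thesis by (auto simp: H_def bead_set_def)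
  qed (simp add: H_def)
  have Hs_iter: "H (x - int k * s)" if "H x" for x k
  proof (induction k)
    case (Suc k)
    have "x - int (Suc k) * s = x - int k * s - s" by (simp add: algebra_simps)
    with Hs[OF Suc] show ?case by (simp only:)
  qed (use that in simp)
  have Ht_iter: "H (x - int k * t)" if "H x" for x k
  proof (induction k)
    case (Suc k)
    have "x - int (Suc k) * t = x - int k * t - t" by (simp add: algebra_simps)
    with Ht[OF Suc] show ?case by (simp only:)
  qed (use that in simp)
  have adj: "\<not> H (x + 1)" if "0 \<le> x" "H x" for x
  proof -
    have "nat (x + 1) = Suc (nat x)" using that by simp
    with assms that show ?thesis by (auto simp: H_def bead_set_def)
  qed
  have column: "\<not> H (x + (s + 1))" if "0 \<le> x" "H x" for x
    using adj[OF that] Hs[of "x + (s + 1)"] by (auto simp: algebra_simps)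
  obtain M where M: "\<And>x. H x \<Longrightarrow> x \<le> M" "0 \<le> M"
  proof
    show "x \<le> int (Max (insert 0 B))" if "H x" for x
    proof (cases "x < 0")
      case False
      with that have "nat x \<in> insert 0 B" by (simp add: H_def)
      with fin have "nat x \<le> Max (insert 0 B)" by (intro Max_ge) auto
      with False show ?thesis by linarith
    qed linarith
  qed simp
  define A where "A = {m::nat. H (int m * t - 1)}"
  \<comment> \<open>\<open>(n+1)(2n+3) - 1 = (n+2)(2n+1)\<close> would lead down to \<open>0\<close>, which bounds \<open>A\<close> by \<open>n\<close>\<close>
  have A_le: "m \<le> n" if "m \<in> A" for m
  proof (rule ccontr)
    assume "\<not> m \<le> n"
    then have m: "int (m - (n + 1)) = int m - (int n + 1)" by simp
    have "H (int m * t - 1 - int (m - (n + 1)) * t)" using that Ht_iter by (simp add: A_def)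
    also have "int m * t - 1 - int (m - (n + 1)) * t = int (n + 2) * s"
      unfolding m by (simp add: s_def t_def algebra_simps)
    finally have "H (int (n + 2) * s - int (n + 2) * s)" by (rule Hs_iter)
    with zero show False by (simp only: diff_self)
  qed
  have A_fin: "finite A" by (rule finite_subset[of _ "{..n}"]) (use A_le in auto)
  have "0 \<in> A" by (simp add: A_def neg)
  have A_iff: "m \<in> A \<longleftrightarrow> H (int m * t - 1)" for m by (simp add: A_def)
  have Max_A: "Max A \<in> A" using Max_in[OF A_fin] \<open>0 \<in> A\<close> by blast
  define a where "a = int (Max A)"
  have a_in: "H (a * t - 1)"
    using Max_A unfolding A_iff a_def .
  have a_max: "\<not> H ((a + 1) * t - 1)"
  proof
    assume "H ((a + 1) * t - 1)"
    then have "Suc (Max A) \<in> A" unfolding A_iff a_def by (simp add: algebra_simps)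
    with Max_ge[OF A_fin, of "Suc (Max A)"] show False by simp
  qed
  have a_bounds: "0 \<le> a" "a \<le> int n"
    using A_le[OF Max_A] by (auto simp: a_def)
  define b where "b i = Max (insert 0 {l. 1 \<le> l \<and> H (entry n a i l)})" for i
  have lev_fin: "finite {l. 1 \<le> l \<and> H (entry n a i l)}" if "i \<le> 2 * n + 1" for i
  proof (rule finite_subset)
    show "{l. 1 \<le> l \<and> H (entry n a i l)} \<subseteq> {1..M + 2 * int n + 2}"
    proof clarify
      fix l assume l: "1 \<le> l" "H (entry n a i l)"
      have "l \<le> (2 * int n + 2) * l" using l(1) mult_right_mono[of 1 "2 * int n + 2" l] by simp
      also have "(2 * int n + 2) * l \<le> M + 2 * int n + 2"
        using M(1)[OF l(2)] that a_bounds by (simp add: entry_def)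
      finally show "l \<in> {1..M + 2 * int n + 2}" using l(1) by simp
    qed
  qed simp
  have b_ge: "l \<le> b i" if "i \<le> 2 * n + 1" "1 \<le> l" "H (entry n a i l)" for i l
    unfolding b_def using lev_fin[OF that(1)] that by (intro Max_ge) auto
  have b_nonneg: "0 \<le> b i" if "i \<le> 2 * n + 1" for i
    unfolding b_def using lev_fin[OF that] by (intro Max_ge) auto
  have b_in: "H (entry n a i (b i))" if "i \<le> 2 * n + 1" "1 \<le> b i" for i
  proof -
    have "b i \<in> insert 0 {l. 1 \<le> l \<and> H (entry n a i l)}"
      unfolding b_def using lev_fin[OF that(1)] by (intro Max_in) auto
    with that show ?thesis by auto
  qed
  have descend: "H (entry n a i l')" if "H (entry n a i l)" "l' \<le> l" "even (l - l')" for i l l'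
  proof -
    define k where "k = nat ((l - l') div 2)"
    have "l - l' = 2 * int k" using that by (auto simp: k_def)
    then have "entry n a i l' = entry n a i l - int k * s - int k * t"
      by (simp add: entry_def s_def t_def algebra_simps)
    with Ht_iter[OF Hs_iter[OF that(1)]] show ?thesis by simp
  qed
  have parity: "even (l' - l)" if "H (entry n a i l)" "H (entry n a i l')" "0 \<le> entry n a i l" "l \<le> l'" for i l l'
  proof (rule ccontr)
    assume "odd (l' - l)"
    then have "l \<noteq> l'" "even (l' - (l + 1))" by auto
    with that(4) have "H (entry n a i (l + 1))" by (intro descend[OF that(2)]) simp_all
    moreover have "entry n a i (l + 1) = entry n a i l + (s + 1)"
      by (simp add: entry_def s_def algebra_simps)
    ultimately show False using column[OF that(3,1)] by simp
  qed
  have b0: "b 0 = a"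
  proof (rule antisym)
    have top: "H (entry n a 0 a)" using a_in by (simp add: entry_def t_def algebra_simps)
    show "a \<le> b 0" using b_ge[OF _ _ top] b_nonneg[of 0] by (cases "1 \<le> a") auto
    show "b 0 \<le> a"
    proof (rule ccontr)
      assume "\<not> b 0 \<le> a"
      then have gt: "a < b 0" and H: "H (entry n a 0 (b 0))" using b_in[of 0] a_bounds by auto
      have even: "even (b 0 - a)"
      proof (cases "1 \<le> a")
        case True
        with parity[OF top H] gt entry_nonneg[OF a_bounds(1) _ True] show ?thesis by simp
      next
        case False
        then have "a = 0" using a_bounds by simp
        show ?thesis
        proof (rule ccontr)
          assume "odd (b 0 - a)"
          with gt \<open>a = 0\<close> descend[OF H, of 1] have "H (entry n a 0 1)" by auto
          then have "H s" using \<open>a = 0\<close> by (simp add: entry_def s_def add.commute)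
          with Hs[of s] zero show False by simp
        qed
      qed
      with gt have "a + 2 \<le> b 0" by presburger
      with even descend[OF H, of "a + 2"] have "H (entry n a 0 (a + 2))" by auto
      from Hs[OF this] a_max show False by (simp add: entry_def s_def t_def algebra_simps)
    qed
  qed
  have bL: "b (2 * n + 1) = a"
  proof (rule antisym)
    have top: "H (entry n a (2 * n + 1) a)"
      using Hs[OF a_in] by (simp add: entry_def s_def t_def algebra_simps)
    show "a \<le> b (2 * n + 1)" using b_ge[OF _ _ top] b_nonneg[of "2 * n + 1"] by (cases "1 \<le> a") auto
    show "b (2 * n + 1) \<le> a"
    proof (rule ccontr)
      assume "\<not> b (2 * n + 1) \<le> a"
      then have gt: "a < b (2 * n + 1)" and H: "H (entry n a (2 * n + 1) (b (2 * n + 1)))"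
        using b_in[of "2 * n + 1"] a_bounds by auto
      have even: "even (b (2 * n + 1) - a)"
      proof (cases "1 \<le> a")
        case True
        with parity[OF top H] gt entry_nonneg[OF a_bounds(1) _ True] show ?thesis by simp
      next
        case False
        then have "a = 0" using a_bounds by simp
        show ?thesis
        proof (rule ccontr)
          assume "odd (b (2 * n + 1) - a)"
          with gt \<open>a = 0\<close> descend[OF H, of 1] have "H (entry n a (2 * n + 1) 1)" by auto
          with zero \<open>a = 0\<close> show False by (simp add: entry_def)
        qed
      qed
      with gt have "a + 2 \<le> b (2 * n + 1)" by presburger
      with even descend[OF H, of "a + 2"] have "H (entry n a (2 * n + 1) (a + 2))" by auto
      with a_max show False by (simp add: entry_def t_def algebra_simps)
    qed
  qed
  have step: "\<bar>b (Suc i) - b i\<bar> = 1 \<or> b i = 0 \<and> b (Suc i) = 0" if i: "i \<le> 2 * n" for i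
  proof -
    have i': "i \<le> 2 * n + 1" "Suc i \<le> 2 * n + 1" using i by auto
    have down: "entry n a (Suc i) (l - 1) = entry n a i l - t" "entry n a i (l - 1) = entry n a (Suc i) l - s" for l
      by (simp_all add: entry_def s_def t_def algebra_simps)
    have 1: "b i - 1 \<le> b (Suc i)"
    proof (cases "2 \<le> b i")
      case True
      with Ht[OF b_in[OF i'(1)]] show ?thesis by (intro b_ge[OF i'(2)]) (auto simp: down)
    qed (use b_nonneg[OF i'(2)] in auto)
    have 2: "b (Suc i) - 1 \<le> b i"
    proof (cases "2 \<le> b (Suc i)")
      case True
      with Hs[OF b_in[OF i'(2)]] show ?thesis by (intro b_ge[OF i'(1)]) (auto simp: down)
    qed (use b_nonneg[OF i'(1)] in auto)
    have 3: "b i \<noteq> b (Suc i)" if "1 \<le> b i"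
    proof
      assume eq: "b i = b (Suc i)"
      with that have "H (entry n a (Suc i) (b i))" "H (entry n a i (b i))" "0 \<le> entry n a (Suc i) (b i)"
        using b_in[OF i'(1)] b_in[OF i'(2)] entry_nonneg[OF a_bounds(1) i'(2)] by auto
      moreover have "entry n a i (b i) = entry n a (Suc i) (b i) + 1" by (simp add: entry_def)
      ultimately show False using adj by metis
    qed
    from 1 2 3 b_nonneg[OF i'(1)] b_nonneg[OF i'(2)] show ?thesis by linarith
  qed
  have profile: "profile n a b"
    using a_bounds b0 bL b_nonneg step by (simp add: profile_def)
  have start: "1 \<le> b i" if "int i < a" for i
    using profile_start(1)[OF profile, of i] that by simp
  have "below n a b = B"
  proof (intro equalityI subsetI)
    fix x assume "x \<in> below n a b"
    then obtain i l where il: "0 < x" "i \<le> 2 * n + 1" "0 \<le> l" "l \<le> b i" "even (b i - l)" "int x = entry n a i l"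
      by (auto simp: below_def)
    have "1 \<le> b i"
    proof (rule ccontr)
      assume "\<not> 1 \<le> b i"
      with il have "l = 0" by simp
      with il(1,6) have "int i < a" by (simp add: entry_def)
      with start \<open>\<not> 1 \<le> b i\<close> show False by simp
    qed
    with descend[OF b_in[OF il(2)] il(4,5)] il(6) have "H (int x)" by simp
    then show "x \<in> B" by (simp add: H_def)
  next
    fix x assume "x \<in> B"
    then have H: "H (int x)" and pos: "0 < x" using zero by (auto simp: H_def intro: gr0I)
    obtain i l where il: "i \<le> 2 * n + 1" "int x = entry n a i l" using ex_entry by blast
    have nn: "0 \<le> entry n a i l" using il(2) by simp
    then have l: "0 \<le> l" using level_nonneg a_bounds by blast
    have le: "l \<le> b i" and b1: "1 \<le> b i"
    proof -
      show "1 \<le> b i"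
      proof (cases "l = 0")
        case True
        with il(2) pos have "int i < a" by (simp add: entry_def)
        then show ?thesis by (rule start)
      next
        case False
        with l b_ge[OF il(1), of l] H il(2) show ?thesis by simp
      qed
      then show "l \<le> b i" using l b_ge[OF il(1), of l] H il(2) by (cases "l = 0") auto
    qed
    have "even (b i - l)" using parity[OF _ b_in[OF il(1) b1] nn le] H il(2) by simp
    with il pos l le show "x \<in> below n a b" by (auto simp: below_def)
  qed
  with profile show ?thesis by blast
qed

section \<open>The size in terms of the outline\<close>

text \<open>The positive levels that carry beads in a column of height \<open>m\<close>.\<close>

definition rungs :: "int \<Rightarrow> int set" where
  "rungs m = {l. 1 \<le> l \<and> l \<le> m \<and> even (m - l)}"

lemma rungs_facts:
  assumes "0 \<le> m"
  shows "finite (rungs m)" "int (card (rungs m)) = (m + 1) div 2"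
    "\<Sum>(rungs m) = ((m + 1) div 2) * ((m + 2) div 2)"
proof -
  have "finite (rungs (int k)) \<and> int (card (rungs (int k))) = (int k + 1) div 2 \<and>
    \<Sum>(rungs (int k)) = ((int k + 1) div 2) * ((int k + 2) div 2)" for k
  proof (induction k rule: nat_induct2)
    case 0
    have "rungs (int 0) = {}" by (auto simp: rungs_def)
    then show ?case by simp
  next
    case 1
    have "rungs (int 1) = {1}" by (auto simp: rungs_def)
    then show ?case by simp
  next
    case (step k)
    have "rungs (int (k + 2)) = insert (int k + 2) (rungs (int k))"
      unfolding rungs_def by (auto simp: set_eq_iff) presburger+
    moreover have "int k + 2 \<notin> rungs (int k)" by (simp add: rungs_def)
    moreover have "(int k + 2 + 1) div 2 = (int k + 1) div 2 + 1" "(int k + 2 + 2) div 2 = (int k + 2) div 2 + 1"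
      "(int k + 1) div 2 + (int k + 2) div 2 = int k + 1" by presburger+
    ultimately show ?case using step by (simp add: algebra_simps)
  qed
  from this[of "nat m"] assms show "finite (rungs m)" "int (card (rungs m)) = (m + 1) div 2"
    "\<Sum>(rungs m) = ((m + 1) div 2) * ((m + 2) div 2)" by simp_all
qed

text \<open>Two neighbouring columns together use every positive level up to the higher summit exactly once. This
removes all dependence on the parity of the heights from the size formula below.\<close>

lemma rungs_pair:
  assumes "0 \<le> m" "0 \<le> m'" "\<bar>m' - m\<bar> = 1 \<or> m = 0 \<and> m' = 0"
  shows "int (card (rungs m)) + int (card (rungs m')) = max m m'"
    and "2 * (\<Sum>(rungs m) + \<Sum>(rungs m')) = max m m' * (max m m' + 1)"
proof -
  have *: "int (card (rungs (k + 1))) + int (card (rungs k)) = k + 1 \<and>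
    2 * (\<Sum>(rungs (k + 1)) + \<Sum>(rungs k)) = (k + 1) * (k + 2)" if "0 \<le> k" for k
  proof (cases "even k")
    case True
    then obtain q where "k = 2 * q" by blast
    with that show ?thesis by (simp add: rungs_facts algebra_simps)
  next
    case False
    then obtain q where "k = 2 * q + 1" by (rule oddE)
    with that show ?thesis by (simp add: rungs_facts algebra_simps)
  qed
  have "int (card (rungs m)) + int (card (rungs m')) = max m m' \<and>
    2 * (\<Sum>(rungs m) + \<Sum>(rungs m')) = max m m' * (max m m' + 1)"
  proof -
    consider "m' = m + 1" | "m = m' + 1" | "m = 0" "m' = 0" using assms(3) by linarith
    then show ?thesis
    proof cases
      case 1 with *[OF assms(1)] show ?thesis by (simp add: max_def algebra_simps)
    next
      case 2 with *[OF assms(2)] show ?thesis by (simp add: max_def algebra_simps)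
    next
      case 3 then show ?thesis by (simp add: rungs_facts)
    qed
  qed
  then show "int (card (rungs m)) + int (card (rungs m')) = max m m'"
    and "2 * (\<Sum>(rungs m) + \<Sum>(rungs m')) = max m m' * (max m m' + 1)" by auto
qed

lemma sum_adjacent_pairs:
  fixes f :: "nat \<Rightarrow> real"
  shows "(\<Sum>i<L. f i + f (Suc i)) = 2 * (\<Sum>i\<le>L. f i) - f 0 - f L"
    and "(\<Sum>i<L. (real i + 1 / 2) * (f i + f (Suc i)))
      = 2 * (\<Sum>i\<le>L. real i * f i) + f 0 / 2 - (real L + 1 / 2) * f L"
  by (induction L) (simp_all add: algebra_simps)

lemma sum_odd_below:
  "(\<Sum>j<a. of_bool (odd j)) = a div 2" "(\<Sum>j<a. of_bool (odd j) * j) = (a div 2)\<^sup>2" for a :: nat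
proof -
  show "(\<Sum>j<a. of_bool (odd j)) = a div 2"
    by (induction a) auto
  show "(\<Sum>j<a. of_bool (odd j) * j) = (a div 2)\<^sup>2"
  proof (induction a)
    case (Suc a)
    show ?case
    proof (cases "even a")
      case False
      then obtain q where "a = 2 * q + 1" by (rule oddE)
      with Suc show ?thesis by (simp add: power2_eq_square algebra_simps)
    qed (use Suc in simp)
  qed simp
qed

context
  fixes n :: nat and a :: int and b :: "nat \<Rightarrow> int"
  assumes profile: "profile n a b"
begin

text \<open>Besides the positive levels, level \<open>0\<close> contributes the odd numbers below \<open>a\<close>.\<close>

lemma sum_below:
  fixes f :: "int \<Rightarrow> int"
  shows "(\<Sum>x\<in>below n a b. f (int x))
    = (\<Sum>i\<le>2 * n + 1. \<Sum>l\<in>rungs (b i). f (entry n a i l))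
      + (\<Sum>j<nat a. of_bool (odd j) * f (int j))"
proof -
  note bounds = profile_bounds[OF profile]
  define R where "R i = rungs (b i) \<union> (if int i < a \<and> even (b i) then {0} else {})" for i
  have fin: "finite (R i)" if "i \<le> 2 * n + 1" for i
    using rungs_facts(1)[OF bounds(5)[OF that]] by (simp add: R_def)
  have pos: "0 < entry n a i l" if "i \<le> 2 * n + 1" "l \<in> R i" for i l
  proof -
    have l: "0 \<le> l" "l \<le> b i" "even (b i - l)" "l = 0 \<Longrightarrow> int i < a"
      using that bounds(5)[OF that(1)] by (auto simp: R_def rungs_def split: if_splits)
    have "0 \<le> entry n a i l"
    proof (cases "l = 0")
      case True
      with l(4) show ?thesis by (simp add: entry_def)
    next
      case False
      with l(1) show ?thesis by (intro entry_nonneg[OF bounds(1) that(1)]) auto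
    qed
    with entry_nonzero[OF profile that(1) l(1-3)] show ?thesis by simp
  qed
  have "bij_betw (\<lambda>(i, l). nat (entry n a i l)) (SIGMA i:{..2 * n + 1}. R i) (below n a b)"
  proof (rule bij_betwI')
    fix u v assume "u \<in> (SIGMA i:{..2 * n + 1}. R i)" "v \<in> (SIGMA i:{..2 * n + 1}. R i)"
    then obtain i l i' l' where uv: "u = (i, l)" "v = (i', l')" "i \<le> 2 * n + 1" "i' \<le> 2 * n + 1" "l \<in> R i" "l' \<in> R i'"
      by auto
    have "nat (entry n a i l) = nat (entry n a i' l') \<longleftrightarrow> entry n a i l = entry n a i' l'"
      using pos[OF uv(3,5)] pos[OF uv(4,6)] by auto
    then show "((\<lambda>(i, l). nat (entry n a i l)) u = (\<lambda>(i, l). nat (entry n a i l)) v) = (u = v)"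
      using entry_inject[OF _ uv(3,4), of a l l'] uv(1,2) by auto
  next
    fix u assume "u \<in> (SIGMA i:{..2 * n + 1}. R i)"
    then obtain i l where u: "u = (i, l)" "i \<le> 2 * n + 1" "l \<in> R i" by auto
    then have "0 \<le> l" "l \<le> b i" "even (b i - l)"
      using bounds(5)[OF u(2)] by (auto simp: R_def rungs_def split: if_splits)
    with pos[OF u(2,3)] show "(\<lambda>(i, l). nat (entry n a i l)) u \<in> below n a b"
      unfolding u(1) prod.case by (intro belowI[OF profile u(2)]) auto
  next
    fix x assume "x \<in> below n a b"
    then obtain i l where il: "0 < x" "i \<le> 2 * n + 1" "0 \<le> l" "l \<le> b i" "even (b i - l)" "int x = entry n a i l"
      unfolding below_def by blast
    have "l \<in> R i"
    proof (cases "l = 0")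
      case True
      with il have "int i < a" by (simp add: entry_def)
      with True il(5) show ?thesis by (simp add: R_def)
    qed (use il in \<open>simp add: R_def rungs_def\<close>)
    moreover have "x = nat (entry n a i l)" using il(6) by simp
    ultimately show "\<exists>u\<in>SIGMA i:{..2 * n + 1}. R i. x = (\<lambda>(i, l). nat (entry n a i l)) u"
      using il(2) by (intro bexI[of _ "(i, l)"]) auto
  qed
  then have "(\<Sum>x\<in>below n a b. f (int x))
      = (\<Sum>u\<in>(SIGMA i:{..2 * n + 1}. R i). f (int ((\<lambda>(i, l). nat (entry n a i l)) u)))"
    by (rule sum.reindex_bij_betw[symmetric])
  also have "\<dots> = (\<Sum>(i, l)\<in>(SIGMA i:{..2 * n + 1}. R i). f (entry n a i l))"
    using pos by (intro sum.cong) force+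
  also have "\<dots> = (\<Sum>i\<le>2 * n + 1. \<Sum>l\<in>R i. f (entry n a i l))"
    using fin by (subst sum.Sigma) auto
  also have "\<dots> = (\<Sum>i\<le>2 * n + 1. (\<Sum>l\<in>rungs (b i). f (entry n a i l))
      + (if int i < a \<and> even (a - int i) then f (a - 1 - int i) else 0))"
  proof (rule sum.cong)
    fix i assume "i \<in> {..2 * n + 1}"
    then have i: "i \<le> 2 * n + 1" by simp
    have "0 \<notin> rungs (b i)" by (simp add: rungs_def)
    moreover have "even (b i) \<longleftrightarrow> even (a - int i)" if "int i < a"
      using profile_start(2)[OF profile, of i] that by (simp add: even_diff_iff)
    ultimately show "(\<Sum>l\<in>R i. f (entry n a i l)) = (\<Sum>l\<in>rungs (b i). f (entry n a i l))
      + (if int i < a \<and> even (a - int i) then f (a - 1 - int i) else 0)"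
      using rungs_facts(1)[OF bounds(5)[OF i]] by (auto simp: R_def entry_def)
  qed simp
  also have "\<dots> = (\<Sum>i\<le>2 * n + 1. \<Sum>l\<in>rungs (b i). f (entry n a i l))
      + (\<Sum>i\<le>2 * n + 1. if int i < a \<and> even (a - int i) then f (a - 1 - int i) else 0)"
    by (rule sum.distrib)
  also have "(\<Sum>i\<le>2 * n + 1. if int i < a \<and> even (a - int i) then f (a - 1 - int i) else 0)
      = (\<Sum>i<nat a. if even (a - int i) then f (a - 1 - int i) else 0)"
    using bounds(2) by (intro sum.mono_neutral_cong_right) auto
  also have "\<dots> = (\<Sum>j<nat a. of_bool (odd j) * f (int j))"
  proof (rule sum.reindex_bij_witness[of _ "\<lambda>j. nat a - 1 - j" "\<lambda>i. nat a - 1 - i"])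
    fix i assume "i \<in> {..<nat a}"
    then have i: "int (nat a - 1 - i) = a - 1 - int i" by auto
    have "odd (nat a - 1 - i) \<longleftrightarrow> odd (a - 1 - int i)" unfolding i[symmetric] by simp
    also have "\<dots> \<longleftrightarrow> even (a - int i)" by presburger
    finally show "of_bool (odd (nat a - 1 - i)) * f (int (nat a - 1 - i))
        = (if even (a - int i) then f (a - 1 - int i) else 0)"
      unfolding i by simp
  qed auto
  finally show ?thesis .
qed

text \<open>The left-hand side is the size of the partition whose beads are the region. Sums over columns
are rewritten as sums over pairs of neighbouring columns, where \<open>rungs_pair\<close> applies; the
corrections at the two ends and the contribution of level \<open>0\<close> combine to a multiple of
\<open>a(a+1)\<close>.\<close>

lemma size_below:
  "real (\<Sum>(below n a b)) - real (card (below n a b)) * (real (card (below n a b)) - 1) / 2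
   = (real n + 1) / 2 * (\<Sum>i\<le>2 * n. of_int ((max (b i) (b (Suc i)))\<^sup>2))
     - (\<Sum>i\<le>2 * n. of_int (max (b i) (b (Suc i))))\<^sup>2 / 8
     - (\<Sum>i\<le>2 * n. of_int (max (b i) (b (Suc i))) * (real i - real n)) / 2
     + (2 * real n + 3) / 4 * of_int (a * (a + 1))"
proof -
  note bounds = profile_bounds[OF profile]
  define N where "N = 2 * n + 1"
  define M where "M i = real_of_int (max (b i) (b (Suc i)))" for i
  define c where "c i = real (card (rungs (b i)))" for i
  define s where "s i = real_of_int (\<Sum>(rungs (b i)))" for i
  \<comment> \<open>the number of odd numbers below \<open>a\<close>, the beads at level \<open>0\<close>\<close>
  define e where "e = real (nat a div 2)"
  have range: "{..2 * n} = {..<N}" by (auto simp: N_def)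
  have pair: "c i + c (Suc i) = M i" "s i + s (Suc i) = (M i)\<^sup>2 / 2 + M i / 2" if "i < N" for i
  proof -
    from that have i: "i \<le> 2 * n" "i \<le> 2 * n + 1" "Suc i \<le> 2 * n + 1" by (auto simp: N_def)
    note p = rungs_pair[OF bounds(5)[OF i(2)] bounds(5)[OF i(3)] profile_step[OF profile i(1)]]
    from arg_cong[OF p(1), of real_of_int] show "c i + c (Suc i) = M i" by (simp add: c_def M_def)
    from arg_cong[OF p(2), of real_of_int] show "s i + s (Suc i) = (M i)\<^sup>2 / 2 + M i / 2"
      unfolding s_def M_def by (simp only: of_int_mult of_int_add) (simp add: power2_eq_square algebra_simps)
  qed
  define A where "A = (\<Sum>i<N. M i)"
  define Q where "Q = (\<Sum>i<N. (M i)\<^sup>2)"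
  define T where "T = (\<Sum>i<N. (real i + 1 / 2) * M i)"
  have ends: "c 0 = c N" "s 0 = s N" unfolding c_def s_def N_def bounds(3,4) by (rule refl)+
  have A: "A = 2 * (\<Sum>i\<le>N. c i) - 2 * c 0"
    using sum_adjacent_pairs(1)[where f = c and L = N] pair(1) ends by (simp add: A_def)
  have Q: "Q / 2 + A / 2 = 2 * (\<Sum>i\<le>N. s i) - 2 * s 0"
    using sum_adjacent_pairs(1)[where f = s and L = N] pair(2) ends
    by (simp add: A_def Q_def sum.distrib sum_divide_distrib)
  have T: "T = 2 * (\<Sum>i\<le>N. real i * c i) - real N * c 0"
    using sum_adjacent_pairs(2)[where f = c and L = N] pair(1) ends by (simp add: T_def algebra_simps)
  have card: "real (card (below n a b)) = (\<Sum>i\<le>N. c i) + e"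
  proof -
    have "int (card (below n a b)) = (\<Sum>i\<le>2 * n + 1. int (card (rungs (b i)))) + int (\<Sum>j<nat a. of_bool (odd j))"
      using sum_below[of "\<lambda>_. 1"] by simp
    from arg_cong[OF this, of real_of_int] show ?thesis
      unfolding sum_odd_below by (simp add: c_def e_def N_def)
  qed
  have sum: "real (\<Sum>(below n a b)) = (2 * real n + 2) * (\<Sum>i\<le>N. s i) + (of_int a - 1) * (\<Sum>i\<le>N. c i)
      - (\<Sum>i\<le>N. real i * c i) + e\<^sup>2"
  proof -
    have "int (\<Sum>(below n a b)) = (\<Sum>i\<le>N. \<Sum>l\<in>rungs (b i). entry n a i l) + int (\<Sum>j<nat a. of_bool (odd j) * j)"
      using sum_below[of "\<lambda>x. x"] by (simp add: N_def)
    moreover have "(\<Sum>l\<in>rungs (b i). entry n a i l)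
        = (2 * int n + 2) * \<Sum>(rungs (b i)) + (a - 1 - int i) * int (card (rungs (b i)))" for i
    proof -
      have "(\<Sum>l\<in>rungs (b i). entry n a i l) = (\<Sum>l\<in>rungs (b i). (2 * int n + 2) * l + (a - 1 - int i))"
        by (intro sum.cong) (auto simp: entry_def)
      then show ?thesis by (simp add: sum.distrib sum_distrib_left mult.commute[of "a - 1 - int i"])
    qed
    ultimately have "int (\<Sum>(below n a b)) = (\<Sum>i\<le>N. (2 * int n + 2) * \<Sum>(rungs (b i))
        + (a - 1 - int i) * int (card (rungs (b i)))) + int ((nat a div 2)\<^sup>2)"
      unfolding sum_odd_below by simp
    from arg_cong[OF this, of real_of_int]
    have "real (\<Sum>(below n a b)) = (\<Sum>i\<le>N. (2 * real n + 2) * s i + (of_int a - 1 - real i) * c i) + e\<^sup>2"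
      by (simp add: s_def c_def e_def)
    also have "(\<Sum>i\<le>N. (2 * real n + 2) * s i + (of_int a - 1 - real i) * c i)
        = (\<Sum>i\<le>N. (2 * real n + 2) * s i + (of_int a - 1) * c i - real i * c i)"
      by (intro sum.cong) (auto simp: algebra_simps)
    finally show ?thesis by (simp only: sum.distrib sum_subtractf sum_distrib_left)
  qed
  have corner: "c 0 + e = a" "s 0 = c 0 * (e + 1)" "c 0 = e \<or> c 0 = e + 1"
  proof -
    have a: "0 \<le> a" by (rule bounds(1))
    have "int (nat a div 2) = a div 2" using a by (simp add: zdiv_int)
    then have e: "e = real_of_int (a div 2)" by (metis e_def of_int_of_nat_eq)
    have c0: "c 0 = real_of_int ((a + 1) div 2)"
      using arg_cong[OF rungs_facts(2)[OF a], of real_of_int] by (simp add: c_def bounds(3))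
    have s0: "s 0 = real_of_int ((a + 1) div 2) * real_of_int ((a + 2) div 2)"
      using rungs_facts(3)[OF a] by (simp add: s_def bounds(3))
    have "(a + 1) div 2 + a div 2 = a" by presburger
    then show "c 0 + e = a" unfolding c0 e by linarith
    have half: "(a + 2) div 2 = a div 2 + 1" by presburger
    show "s 0 = c 0 * (e + 1)" unfolding c0 s0 e half by simp
    have "(a + 1) div 2 = a div 2 \<or> (a + 1) div 2 = a div 2 + 1" by presburger
    then show "c 0 = e \<or> c 0 = e + 1" unfolding c0 e by linarith
  qed
  have "real (\<Sum>(below n a b)) - real (card (below n a b)) * (real (card (below n a b)) - 1) / 2
      = (real n + 1) / 2 * Q - A\<^sup>2 / 8 - (T - (real n + 1 / 2) * A) / 2 + (2 * real n + 3) / 4 * of_int (a * (a + 1))"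
  proof -
    define X where "X = (\<Sum>i\<le>N. c i)"
    define Y where "Y = (\<Sum>i\<le>N. s i)"
    define Z where "Z = (\<Sum>i\<le>N. real i * c i)"
    have X: "X = A / 2 + c 0" using A unfolding X_def by linarith
    have Y: "Y = Q / 4 + A / 4 + s 0" using Q unfolding Y_def by linarith
    have "real N = 2 * real n + 1" by (simp add: N_def)
    with T have Z: "Z = (T + (2 * real n + 1) * c 0) / 2" by (simp add: Z_def)
    have a: "real_of_int (a * (a + 1)) = (c 0 + e) * (c 0 + e + 1)" "real_of_int a = c 0 + e"
      using corner(1) by simp_all
    from corner(3) show ?thesis
      unfolding card sum X_def[symmetric] Y_def[symmetric] Z_def[symmetric] X Y Z a corner(2)
      by (elim disjE) (simp_all add: power2_eq_square field_simps)
  qed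
  also have "T - (real n + 1 / 2) * A = (\<Sum>i<N. M i * (real i - real n))"
    unfolding T_def A_def sum_distrib_left sum_subtractf[symmetric] by (intro sum.cong) (auto simp: algebra_simps)
  finally show ?thesis unfolding range A_def Q_def M_def by simp
qed

end

section \<open>Two independent random walks\<close>

text \<open>The mean of \<open>f\<close> over the end point of a simple random walk of \<open>n\<close> steps. Averaging the test
function step by step makes all difference equations below pointwise statements about \<open>f\<close>.\<close>

fun walk_mean :: "nat \<Rightarrow> (int \<Rightarrow> real) \<Rightarrow> real" where
  "walk_mean 0 f = f 0"
| "walk_mean (Suc n) f = walk_mean n (\<lambda>x. (f (x + 1) + f (x - 1)) / 2)"

lemma walk_mean_cong:
  assumes "\<And>x. (even x \<longleftrightarrow> even n) \<Longrightarrow> f x = g x"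
  shows "walk_mean n f = walk_mean n g"
  using assms by (induction n arbitrary: f g) auto

lemma walk_mean_linear:
  "walk_mean n (\<lambda>x. a * f x + b * g x) = a * walk_mean n f + b * walk_mean n g"
proof (induction n arbitrary: f g)
  case (Suc n)
  have "walk_mean (Suc n) (\<lambda>x. a * f x + b * g x)
    = walk_mean n (\<lambda>x. a * ((f (x + 1) + f (x - 1)) / 2) + b * ((g (x + 1) + g (x - 1)) / 2))"
    unfolding walk_mean.simps by (rule arg_cong[of _ _ "walk_mean n"]) (auto simp: field_simps)
  also have "\<dots> = a * walk_mean (Suc n) f + b * walk_mean (Suc n) g"
    by (simp only: Suc walk_mean.simps)
  finally show ?case .
qed simp

lemma walk_mean_add: "walk_mean n (\<lambda>x. f x + g x) = walk_mean n f + walk_mean n g"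
  using walk_mean_linear[of n 1 f 1 g] by simp

lemma walk_mean_diff: "walk_mean n (\<lambda>x. f x - g x) = walk_mean n f - walk_mean n g"
  using walk_mean_linear[of n 1 f "-1" g] by simp

lemma walk_mean_cmult: "walk_mean n (\<lambda>x. a * f x) = a * walk_mean n f"
  using walk_mean_linear[of n a f 0 f] by simp

lemma walk_mean_const: "walk_mean n (\<lambda>x. a) = a"
  by (induction n) auto

lemma walk_mean_divide: "walk_mean n (\<lambda>x. f x / a) = walk_mean n f / a"
  using walk_mean_cmult[of n "1 / a" f] by simp

lemma walk_mean_swap:
  "walk_mean p (\<lambda>x. walk_mean q (\<lambda>y. f x y)) = walk_mean q (\<lambda>y. walk_mean p (\<lambda>x. f x y))"
  by (induction p arbitrary: f) (auto simp: walk_mean_add walk_mean_divide)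

lemma walk_mean_uminus: "walk_mean n (\<lambda>x. f (- x)) = walk_mean n f"
proof (induction n arbitrary: f)
  case (Suc n)
  have "walk_mean (Suc n) (\<lambda>x. f (- x)) = walk_mean n (\<lambda>x. (f (- x + 1) + f (- x - 1)) / 2)"
    by (simp add: algebra_simps)
  also have "\<dots> = walk_mean (Suc n) f"
    using Suc[of "\<lambda>x. (f (x + 1) + f (x - 1)) / 2"] by simp
  finally show ?case .
qed simp

lemma walk_mean_plus:
  "walk_mean (p + q) f = walk_mean p (\<lambda>x. walk_mean q (\<lambda>y. f (x + y)))"
proof (induction q arbitrary: f)
  case (Suc q)
  then show ?case by (simp add: algebra_simps)
qed simp

lemma walk_mean_square: "walk_mean n (\<lambda>x. of_int (x\<^sup>2)) = n"
proof (induction n)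
  case (Suc n)
  have "walk_mean (Suc n) (\<lambda>x. of_int (x\<^sup>2)) = walk_mean n (\<lambda>x. of_int (x\<^sup>2) + 1)"
    unfolding walk_mean.simps
    by (rule arg_cong[of _ _ "walk_mean n"]) (auto simp: power2_eq_square algebra_simps)
  with Suc show ?case by (simp add: walk_mean_add walk_mean_const)
qed simp

definition return_prob :: "nat \<Rightarrow> real" where
  "return_prob m = walk_mean (2 * m) (\<lambda>x. of_bool (x = 0))"

lemma walk_mean_point:
  "walk_mean n (\<lambda>x. of_bool (x = 2 * int k - int n)) = (n choose k) / 2 ^ n"
proof (induction n arbitrary: k)
  case 0
  then show ?case by (cases k) auto
next
  case (Suc n)
  have "walk_mean (Suc n) (\<lambda>x. of_bool (x = 2 * int k - int (Suc n)))
    = walk_mean n (\<lambda>x. of_bool (x = 2 * (int k - 1) - int n) / 2 + of_bool (x = 2 * int k - int n) / 2)"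
    unfolding walk_mean.simps by (rule arg_cong[of _ _ "walk_mean n"]) (auto simp: field_simps of_bool_def)
  also have "\<dots> = walk_mean n (\<lambda>x. of_bool (x = 2 * (int k - 1) - int n)) / 2 + (n choose k) / 2 ^ Suc n"
    by (simp add: walk_mean_add walk_mean_divide Suc)
  also have "\<dots> = (Suc n choose k) / 2 ^ Suc n"
  proof (cases k)
    case 0
    have "walk_mean n (\<lambda>x. of_bool (x = 2 * (int 0 - 1) - int n)) = walk_mean n (\<lambda>x. 0)"
    proof -
      have *: "walk_mean n f = walk_mean n g" if "\<And>x. \<bar>x\<bar> \<le> int n \<Longrightarrow> f x = g x" for f g
        using that by (induction n arbitrary: f g) auto
      show ?thesis by (rule *) auto
    qed
    with 0 show ?thesis by (simp add: walk_mean_const)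
  next
    case (Suc j)
    then show ?thesis using Suc.IH[of j] by (simp add: add_divide_distrib)
  qed
  finally show ?case .
qed

lemma return_prob_eq: "return_prob m = (2 * m choose m) / 4 ^ m"
  using walk_mean_point[of "2 * m" m] by (simp add: return_prob_def power_mult)

lemma return_prob_0 [simp]: "return_prob 0 = 1"
  by (simp add: return_prob_def)

lemma return_prob_Suc: "2 * (real m + 1) * return_prob (Suc m) = (2 * real m + 1) * return_prob m"
proof -
  have "Suc m * (2 * Suc m choose Suc m) = (2 * m + 2) * (2 * m + 1 choose m)"
    using Suc_times_binomial_eq[of "2 * m + 1" m] by (simp add: algebra_simps)
  then have "Suc m * (2 * Suc m choose Suc m) = Suc m * (2 * (2 * m + 1 choose m))"
    by (simp add: algebra_simps)
  then have a: "(2 * Suc m choose Suc m) = 2 * (2 * m + 1 choose m)"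
    by (subst (asm) mult_cancel_left) simp
  have "Suc m * (2 * m + 1 choose m) = (2 * m + 1) * (2 * m choose m)"
    using Suc_times_binomial_eq[of "2 * m" m] binomial_symmetric[of m "2 * m + 1"]
    by (simp add: algebra_simps)
  then have "real (Suc m * (2 * m + 1 choose m)) = real ((2 * m + 1) * (2 * m choose m))"
    by (rule arg_cong)
  then have "(real m + 1) * real (2 * m + 1 choose m) = (2 * real m + 1) * real (2 * m choose m)"
    by (simp only: of_nat_mult of_nat_Suc of_nat_add of_nat_numeral of_nat_1 add.commute)
  with a have "(real m + 1) * real (2 * Suc m choose Suc m) = 2 * ((2 * real m + 1) * real (2 * m choose m))"
    by (simp only: of_nat_mult of_nat_numeral)
  moreover have "2 * (real m + 1) * (A / (4 * P)) = (2 * real m + 1) * (B / P)"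
    if "(real m + 1) * A = 2 * ((2 * real m + 1) * B)" "P > 0" for A B P :: real
  proof -
    have "2 * (real m + 1) * (A / (4 * P)) = ((real m + 1) * A) / (2 * P)"
      using that(2) by (simp add: field_simps)
    also have "\<dots> = (2 * real m + 1) * (B / P)" unfolding that(1) using that(2) by simp
    finally show ?thesis .
  qed
  ultimately show ?thesis unfolding return_prob_eq power_Suc by simp
qed

text \<open>For independent walks \<open>X\<close>, \<open>Y\<close> of \<open>p\<close> and \<open>q\<close> steps, the mean of \<open>\<bar>X\<^sup>2 - Y\<^sup>2\<bar>\<close>. Its differences
along \<open>p + q = N\<close> are twice the means of the sign of \<open>X\<^sup>2 - Y\<^sup>2\<close>, and the differences of the
latter come from the event \<open>\<bar>X\<bar> + \<bar>Y\<bar> = 1\<close> alone, whose probability is explicit.\<close>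

definition gap_mean :: "nat \<Rightarrow> nat \<Rightarrow> real" where
  "gap_mean p q = walk_mean p (\<lambda>x. walk_mean q (\<lambda>y. of_int \<bar>x\<^sup>2 - y\<^sup>2\<bar>))"

definition lead_mean :: "nat \<Rightarrow> nat \<Rightarrow> real" where
  "lead_mean p q = walk_mean p (\<lambda>x. walk_mean q (\<lambda>y. of_int (sgn (x\<^sup>2 - y\<^sup>2))))"

lemma gap_mean_sym: "gap_mean p q = gap_mean q p"
  unfolding gap_mean_def by (subst walk_mean_swap) (simp add: abs_minus_commute)

lemma lead_mean_antisym: "lead_mean p q = - lead_mean q p"
proof -
  have swap: "real_of_int (sgn (x\<^sup>2 - y\<^sup>2)) = - 1 * of_int (sgn (y\<^sup>2 - x\<^sup>2))" for x y :: int
    using idom_abs_sgn_class.sgn_minus[of "y\<^sup>2 - x\<^sup>2"] by (simp only: of_int_minus[symmetric] minus_diff_eq mult_minus1)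
  have "lead_mean p q = walk_mean q (\<lambda>y. walk_mean p (\<lambda>x. - 1 * of_int (sgn (y\<^sup>2 - x\<^sup>2))))"
    unfolding lead_mean_def by (subst walk_mean_swap) (simp only: swap[symmetric])
  then show ?thesis unfolding walk_mean_cmult lead_mean_def by simp
qed

lemma walk_mean_cong2:
  assumes "\<And>x y. (even x \<longleftrightarrow> even p) \<Longrightarrow> (even y \<longleftrightarrow> even q) \<Longrightarrow> f x y = g x y"
  shows "walk_mean p (\<lambda>x. walk_mean q (f x)) = walk_mean p (\<lambda>x. walk_mean q (g x))"
  by (intro walk_mean_cong assms)

lemma step_difference:
  "walk_mean (Suc p) (\<lambda>x. walk_mean q (f x)) - walk_mean p (\<lambda>x. walk_mean (Suc q) (f x))
   = walk_mean p (\<lambda>x. walk_mean q (\<lambda>y. (f (x + 1) y + f (x - 1) y - f x (y + 1) - f x (y - 1)) / 2))"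
  by (simp add: walk_mean_add walk_mean_diff walk_mean_divide diff_divide_distrib add_divide_distrib)

lemma abs_square_diff:
  fixes x y :: int assumes "0 \<le> y" "y \<le> x"
  shows "\<bar>x\<^sup>2 - y\<^sup>2\<bar> = x\<^sup>2 - y\<^sup>2"
  using power_mono[OF assms(2,1), of 2] by auto

text \<open>The following pointwise identities are invariant under the symmetries of the square, which
leaves the octant \<open>0 \<le> y \<le> x\<close>, where all absolute values and signs are explicit.\<close>

lemma octant_wlog:
  fixes x y :: int
  assumes swap: "\<And>x y. P x y \<Longrightarrow> P y x" and neg: "\<And>x y. P x y \<Longrightarrow> P (- x) y"
    and octant: "\<And>x y. 0 \<le> y \<Longrightarrow> y \<le> x \<Longrightarrow> even (x + y) = e \<Longrightarrow> P x y"
    and "even (x + y) = e"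
  shows "P x y"
proof -
  have *: "P u v" if "P \<bar>u\<bar> v" for u v
    using that neg[of "\<bar>u\<bar>" v] by (cases "u < 0") auto
  have "P \<bar>x\<bar> \<bar>y\<bar>"
    using octant[of "\<bar>y\<bar>" "\<bar>x\<bar>"] octant[of "\<bar>x\<bar>" "\<bar>y\<bar>"] swap assms(4)
    by (cases "\<bar>y\<bar> \<le> \<bar>x\<bar>") auto
  from *[OF swap[OF *[OF this]]] show ?thesis by (rule swap)
qed

text \<open>Away from the diagonals both squares are smooth, and the difference of the two averages is
\<open>1 - (-1)\<close> times the sign. Equal parity excludes steps across a diagonal; steps starting on a
diagonal cancel by symmetry.\<close>

lemma gap_step_pointwise:
  fixes x y :: int
  assumes "even (x + y)"
  shows "\<bar>(x + 1)\<^sup>2 - y\<^sup>2\<bar> + \<bar>(x - 1)\<^sup>2 - y\<^sup>2\<bar> - \<bar>x\<^sup>2 - (y + 1)\<^sup>2\<bar> - \<bar>x\<^sup>2 - (y - 1)\<^sup>2\<bar>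
    = 4 * sgn (x\<^sup>2 - y\<^sup>2)" (is "?P x y")
proof (rule octant_wlog[where P = ?P and e = True])
  fix x y :: int assume *: "?P x y"
  then show "?P y x"
    using idom_abs_sgn_class.sgn_minus[of "x\<^sup>2 - y\<^sup>2 :: int"] by (simp add: abs_minus_commute)
  have "(- x + 1)\<^sup>2 = (x - 1)\<^sup>2" "(- x - 1)\<^sup>2 = (x + 1)\<^sup>2"
    by (simp_all add: power2_eq_square algebra_simps)
  with * show "?P (- x) y" by simp
next
  fix x y :: int assume xy: "0 \<le> y" "y \<le> x" "even (x + y) = True"
  show "?P x y"
  proof (cases "x = y")
    case True
    then show ?thesis by (simp add: abs_minus_commute)
  next
    case False
    with xy have "y + 2 \<le> x" by presburger
    then have "\<bar>(x + 1)\<^sup>2 - y\<^sup>2\<bar> = (x + 1)\<^sup>2 - y\<^sup>2" "\<bar>(x - 1)\<^sup>2 - y\<^sup>2\<bar> = (x - 1)\<^sup>2 - y\<^sup>2"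
      "\<bar>x\<^sup>2 - (y + 1)\<^sup>2\<bar> = x\<^sup>2 - (y + 1)\<^sup>2" "\<bar>x\<^sup>2 - \<bar>y - 1\<bar>\<^sup>2\<bar> = x\<^sup>2 - \<bar>y - 1\<bar>\<^sup>2"
      using xy by (intro abs_square_diff; simp)+
    moreover have "y\<^sup>2 < x\<^sup>2" using xy False by (intro power_strict_mono) auto
    ultimately show ?thesis by (simp add: power2_eq_square algebra_simps)
  qed
qed (use assms in simp)

lemma sgn_square_diff:
  fixes x y :: int assumes "0 \<le> y" "0 \<le> x"
  shows "sgn (x\<^sup>2 - y\<^sup>2) = sgn (x - y)"
proof -
  have "x\<^sup>2 < y\<^sup>2 \<longleftrightarrow> x < y" "x\<^sup>2 = y\<^sup>2 \<longleftrightarrow> x = y"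
    using assms power_mono_iff[of y x 2] by (auto simp: not_le[symmetric])
  then show ?thesis by (auto simp: sgn_if)
qed

text \<open>With different parities a step may end on a diagonal, where the sign vanishes. For both walks
this costs the same amount, except next to the origin, where a step of the shorter
coordinate in either direction reaches a diagonal.\<close>

lemma lead_step_pointwise:
  fixes x y :: int
  assumes "odd (x + y)"
  shows "sgn ((x + 1)\<^sup>2 - y\<^sup>2) + sgn ((x - 1)\<^sup>2 - y\<^sup>2) - sgn (x\<^sup>2 - (y + 1)\<^sup>2) - sgn (x\<^sup>2 - (y - 1)\<^sup>2)
    = of_bool (\<bar>x\<bar> + \<bar>y\<bar> = 1)" (is "?P x y")
proof (rule octant_wlog[where P = ?P and e = False])
  fix x y :: int assume *: "?P x y"
  then show "?P y x"
    using idom_abs_sgn_class.sgn_minus[of "x\<^sup>2 - (y + 1)\<^sup>2 :: int"] idom_abs_sgn_class.sgn_minus[of "x\<^sup>2 - (y - 1)\<^sup>2 :: int"]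
      idom_abs_sgn_class.sgn_minus[of "(x + 1)\<^sup>2 - y\<^sup>2 :: int"] idom_abs_sgn_class.sgn_minus[of "(x - 1)\<^sup>2 - y\<^sup>2 :: int"] by (simp add: add.commute)
  have "(- x + 1)\<^sup>2 = (x - 1)\<^sup>2" "(- x - 1)\<^sup>2 = (x + 1)\<^sup>2"
    by (simp_all add: power2_eq_square algebra_simps)
  with * show "?P (- x) y" by simp
next
  fix x y :: int assume xy: "0 \<le> y" "y \<le> x" "even (x + y) = False"
  then have "y < x" by presburger
  have "sgn ((x + 1)\<^sup>2 - y\<^sup>2) = sgn (x + 1 - y)" "sgn ((x - 1)\<^sup>2 - y\<^sup>2) = sgn (x - 1 - y)"
    "sgn (x\<^sup>2 - (y + 1)\<^sup>2) = sgn (x - (y + 1))" "sgn (x\<^sup>2 - \<bar>y - 1\<bar>\<^sup>2) = sgn (x - \<bar>y - 1\<bar>)"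
    using xy \<open>y < x\<close> by (intro sgn_square_diff; simp)+
  then show "?P x y" using xy \<open>y < x\<close> by (auto simp: sgn_if of_bool_def)
qed (use assms in simp)

lemma gap_mean_step:
  assumes "even (p + q)"
  shows "gap_mean (Suc p) q - gap_mean p (Suc q) = 2 * lead_mean p q"
proof -
  have "gap_mean (Suc p) q - gap_mean p (Suc q)
      = walk_mean p (\<lambda>x. walk_mean q (\<lambda>y. 2 * of_int (sgn (x\<^sup>2 - y\<^sup>2))))"
    unfolding gap_mean_def step_difference
  proof (rule walk_mean_cong2)
    fix x y :: int assume "even x = even p" "even y = even q"
    with assms have "even (x + y)" by simp
    from arg_cong[OF gap_step_pointwise[OF this], of real_of_int]
    show "(real_of_int \<bar>(x + 1)\<^sup>2 - y\<^sup>2\<bar> + real_of_int \<bar>(x - 1)\<^sup>2 - y\<^sup>2\<bar>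
        - real_of_int \<bar>x\<^sup>2 - (y + 1)\<^sup>2\<bar> - real_of_int \<bar>x\<^sup>2 - (y - 1)\<^sup>2\<bar>) / 2
      = 2 * real_of_int (sgn (x\<^sup>2 - y\<^sup>2))"
      by (simp only: of_int_add of_int_diff of_int_mult of_int_numeral)
  qed
  then show ?thesis by (simp add: walk_mean_cmult lead_mean_def)
qed

definition near_tie_prob :: "nat \<Rightarrow> nat \<Rightarrow> real" where
  "near_tie_prob p q = walk_mean p (\<lambda>x. walk_mean q (\<lambda>y. of_bool (\<bar>x\<bar> + \<bar>y\<bar> = 1)))"

lemma lead_mean_step:
  assumes "odd (p + q)"
  shows "lead_mean (Suc p) q - lead_mean p (Suc q) = near_tie_prob p q / 2"
proof -
  have "lead_mean (Suc p) q - lead_mean p (Suc q)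
      = walk_mean p (\<lambda>x. walk_mean q (\<lambda>y. of_bool (\<bar>x\<bar> + \<bar>y\<bar> = 1) / 2))"
    unfolding lead_mean_def step_difference
  proof (rule walk_mean_cong2)
    fix x y :: int assume "even x = even p" "even y = even q"
    with assms have "odd (x + y)" by simp
    from arg_cong[OF lead_step_pointwise[OF this], of real_of_int]
    show "(real_of_int (sgn ((x + 1)\<^sup>2 - y\<^sup>2)) + real_of_int (sgn ((x - 1)\<^sup>2 - y\<^sup>2))
        - real_of_int (sgn (x\<^sup>2 - (y + 1)\<^sup>2)) - real_of_int (sgn (x\<^sup>2 - (y - 1)\<^sup>2))) / 2
      = of_bool (\<bar>x\<bar> + \<bar>y\<bar> = 1) / 2"
      by (simp only: of_int_add of_int_diff of_int_of_bool)
  qed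
  then show ?thesis by (simp add: walk_mean_divide near_tie_prob_def)
qed

lemma near_tie_prob_sym: "near_tie_prob p q = near_tie_prob q p"
  unfolding near_tie_prob_def by (subst walk_mean_swap) (simp add: add.commute)

text \<open>By parity the even walk is at \<open>0\<close> and the odd one at \<open>\<plusminus>1\<close>, from where one more step leads to \<open>0\<close>
with probability one half.\<close>

lemma near_tie_prob_eq: "near_tie_prob (2 * i) (2 * j + 1) = 2 * return_prob i * return_prob (Suc j)"
proof -
  have "near_tie_prob (2 * i) (2 * j + 1)
      = walk_mean (2 * i) (\<lambda>x. walk_mean (2 * j + 1) (\<lambda>y. of_bool (x = 0) * of_bool (\<bar>y\<bar> = 1)))"
    unfolding near_tie_prob_def by (rule walk_mean_cong2) (auto simp: of_bool_def, presburger+)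
  also have "\<dots> = return_prob i * walk_mean (2 * j + 1) (\<lambda>y. of_bool (\<bar>y\<bar> = 1))"
    by (simp only: walk_mean_cmult return_prob_def mult.commute[of "walk_mean (2 * i) _"]
        mult.commute[of "of_bool (_ = 0)" "walk_mean (2 * j + 1) _"])
  also have "walk_mean (2 * j + 1) (\<lambda>y. of_bool (\<bar>y\<bar> = 1)) = 2 * return_prob (Suc j)"
  proof -
    have "return_prob (Suc j) = walk_mean (2 * j + 1) (\<lambda>y. (of_bool (y + 1 = 0) + of_bool (y - 1 = 0)) / 2)"
      by (simp add: return_prob_def)
    also have "\<dots> = walk_mean (2 * j + 1) (\<lambda>y. of_bool (\<bar>y\<bar> = 1) / 2)"
      by (rule walk_mean_cong) (auto simp: of_bool_def)
    finally show ?thesis by (simp add: walk_mean_divide)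
  qed
  finally show ?thesis by simp
qed

lemma gap_mean_boundary: "gap_mean n 0 = n"
  by (simp add: gap_mean_def walk_mean_square[unfolded of_int_power] abs_power2)


lemma return_prob_shift:
  "real (Suc i) * return_prob (Suc i) = (real i + 1 / 2) * return_prob i"
  using return_prob_Suc[of i] by (simp add: field_simps)

lemma lead_mean_diff:
  assumes "1 \<le> p" "p \<le> 2 * m"
  shows "lead_mean p (2 * m - p) - lead_mean (p - 1) (2 * m - (p - 1))
    = return_prob (p div 2) * return_prob (m - p div 2)"
proof (cases "even p")
  case True
  define i where "i = p div 2 - 1"
  have i: "p = 2 * Suc i" using True assms unfolding i_def by presburger
  have "lead_mean p (2 * m - p) - lead_mean (p - 1) (2 * m - (p - 1))
      = lead_mean (Suc (2 * i + 1)) (2 * (m - Suc i)) - lead_mean (2 * i + 1) (Suc (2 * (m - Suc i)))"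
    using i assms by (intro arg_cong2[where f = minus] arg_cong2[where f = lead_mean]) auto
  also have "\<dots> = near_tie_prob (2 * (m - Suc i)) (2 * i + 1) / 2"
    by (subst lead_mean_step) (simp_all add: near_tie_prob_sym)
  also have "\<dots> = return_prob (p div 2) * return_prob (m - p div 2)"
    unfolding near_tie_prob_eq i by simp
  finally show ?thesis .
next
  case False
  then obtain i where i: "p = 2 * i + 1" by (rule oddE)
  with assms have im: "i < m" by simp
  then have "2 * m - p = 2 * (m - Suc i) + 1" "2 * m - (p - 1) = Suc (2 * (m - Suc i) + 1)" using i by auto
  then have "lead_mean p (2 * m - p) - lead_mean (p - 1) (2 * m - (p - 1))
      = near_tie_prob (2 * i) (2 * (m - Suc i) + 1) / 2"
    using lead_mean_step[of "2 * i" "2 * (m - Suc i) + 1"] i by simp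
  moreover have "p div 2 = i" "Suc (m - Suc i) = m - p div 2" using i im by auto
  ultimately show ?thesis using near_tie_prob_eq[of i "m - Suc i"] by simp
qed

text \<open>Summation by parts against the weight \<open>p(N - p)\<close>, whose second difference is \<open>-2\<close>. At \<open>K = N - 1\<close>
only the sum of \<open>f\<close> and multiples of its boundary values remain.\<close>

lemma sum_second_difference:
  fixes f :: "nat \<Rightarrow> real"
  shows "(\<Sum>p=1..K. real p * (N - real p) * (f (p + 1) - 2 * f p + f (p - 1)))
    = - 2 * (\<Sum>p=1..K. f p) + (N - 1) * f 0 + real K * (N - real K) * f (K + 1)
      - (real K + 1) * (N - real K - 1) * f K"
  by (induction K) (simp_all add: algebra_simps)

lemma lead_mean_0: "lead_mean 0 (2 * m) = return_prob m - 1"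
proof -
  have "lead_mean 0 (2 * m) = walk_mean (2 * m) (\<lambda>y. of_bool (y = 0) - 1)"
    unfolding lead_mean_def walk_mean.simps by (rule walk_mean_cong) (auto simp: sgn_if)
  then show ?thesis by (simp add: walk_mean_diff walk_mean_const return_prob_def)
qed

lemma sum_even_odd:
  fixes g :: "nat \<Rightarrow> 'a :: comm_monoid_add"
  shows "(\<Sum>p\<le>2 * m + 1. g p) = (\<Sum>i\<le>m. g (2 * i) + g (2 * i + 1))"
  by (induction m) (simp_all add: ac_simps)

text \<open>Every summand occurs twice among the increments of \<open>lead_mean\<close>, except that the first and the
last one occur once. The extreme values of \<open>lead_mean\<close> differ from \<open>\<plusminus>1\<close> by the probability of a
tie, which is also the value of these two summands.\<close>

lemma sum_return_prob: "(\<Sum>i\<le>m. return_prob i * return_prob (m - i)) = 1"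
proof -
  define c where "c i = return_prob i * return_prob (m - i)" for i
  have "lead_mean (2 * m) 0 - lead_mean 0 (2 * m) = (\<Sum>p=1..2 * m. c (p div 2))"
  proof -
    have "lead_mean p (2 * m - p) - lead_mean 0 (2 * m) = (\<Sum>i=1..p. c (i div 2))" if "p \<le> 2 * m" for p
      using that
    proof (induction p)
      case (Suc p)
      then show ?case using lead_mean_diff[of "Suc p" m] by (simp add: c_def)
    qed simp
    from this[of "2 * m"] show ?thesis by simp
  qed
  moreover have "lead_mean (2 * m) 0 - lead_mean 0 (2 * m) = 2 - 2 * return_prob m"
    using lead_mean_antisym[of "2 * m" 0] lead_mean_0[of m] by simp
  moreover have "(\<Sum>p\<le>2 * m + 1. c (p div 2)) = 2 * (\<Sum>i\<le>m. c i)"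
    by (simp only: sum_even_odd) (simp add: sum_distrib_left)
  moreover have "(\<Sum>p\<le>2 * m + 1. c (p div 2)) = c 0 + (\<Sum>p=1..2 * m. c (p div 2)) + c m"
    by (simp add: sum.atMost_shift atLeast0AtMost[symmetric] sum.atLeast_Suc_atMost)
  moreover have "c 0 = return_prob m" "c m = return_prob m" by (simp_all add: c_def)
  ultimately show ?thesis by (simp add: c_def)
qed

text \<open>The first moment follows from the symmetry \<open>i \<mapsto> m - i\<close>. The recurrence of the return
probabilities expresses the mixed moment for \<open>m + 1\<close> by the one for \<open>m\<close> and the first moment.\<close>

lemma sum_return_prob_moments:
  "(\<Sum>i\<le>m. real i * (return_prob i * return_prob (m - i))) = m / 2"
  "(\<Sum>i\<le>m. real i * real (m - i) * (return_prob i * return_prob (m - i))) = real m * (real m - 1) / 8"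
proof -
  have first: "(\<Sum>i\<le>m. real i * (return_prob i * return_prob (m - i))) = m / 2" for m
  proof -
    have "(\<Sum>i\<le>m. real i * (return_prob i * return_prob (m - i)))
        = (\<Sum>i\<le>m. real (m - i) * (return_prob i * return_prob (m - i)))"
      by (rule sum.reindex_bij_witness[of _ "\<lambda>i. m - i" "\<lambda>i. m - i"]) auto
    then have "2 * (\<Sum>i\<le>m. real i * (return_prob i * return_prob (m - i)))
        = (\<Sum>i\<le>m. real i * (return_prob i * return_prob (m - i)))
          + (\<Sum>i\<le>m. real (m - i) * (return_prob i * return_prob (m - i)))"
      by linarith
    also have "\<dots> = (\<Sum>i\<le>m. (real i + real (m - i)) * (return_prob i * return_prob (m - i)))"
      by (simp only: sum.distrib distrib_right)
    also have "\<dots> = (\<Sum>i\<le>m. m * (return_prob i * return_prob (m - i)))"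
      by (intro sum.cong) (auto simp: of_nat_diff)
    finally show ?thesis by (simp add: sum_distrib_left[symmetric] sum_return_prob)
  qed
  show "(\<Sum>i\<le>m. real i * (return_prob i * return_prob (m - i))) = m / 2" by (rule first)
  show "(\<Sum>i\<le>m. real i * real (m - i) * (return_prob i * return_prob (m - i))) = real m * (real m - 1) / 8"
  proof (induction m)
    case (Suc m)
    have "(\<Sum>i\<le>Suc m. real i * real (Suc m - i) * (return_prob i * return_prob (Suc m - i)))
        = (\<Sum>i\<le>m. real (m - i) * (real (Suc i) * return_prob (Suc i)) * return_prob (m - i))"
      by (subst sum.atMost_Suc_shift) (simp add: algebra_simps)
    also have "\<dots> = (\<Sum>i\<le>m. real i * real (m - i) * (return_prob i * return_prob (m - i))
        + real (m - i) * (return_prob i * return_prob (m - i)) / 2)"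
      by (simp only: return_prob_shift) (simp add: field_simps)
    also have "\<dots> = real m * (real m - 1) / 8 + (\<Sum>i\<le>m. real (m - i) * (return_prob i * return_prob (m - i))) / 2"
      by (simp only: sum.distrib sum_divide_distrib Suc)
    also have "(\<Sum>i\<le>m. real (m - i) * (return_prob i * return_prob (m - i)))
        = (\<Sum>i\<le>m. real i * (return_prob i * return_prob (m - i)))"
      by (rule sum.reindex_bij_witness[of _ "\<lambda>i. m - i" "\<lambda>i. m - i"]) auto
    also note first
    finally have "(\<Sum>i\<le>Suc m. real i * real (Suc m - i) * (return_prob i * return_prob (Suc m - i)))
      = real m * (real m - 1) / 8 + real m / 2 / 2" .
    then show ?case by (simp only:) (simp add: field_simps)
  qed simp
qed

text \<open>The second difference of the summand is twice a product of two return probabilities, so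
summation by parts leaves only their moments.\<close>

lemma sum_gap_mean:
  "(\<Sum>p\<le>2 * m + 1. gap_mean p (2 * m + 1 - p)) = (real m + 1) * (3 * real m + 2)"
proof -
  define N where "N = 2 * m + 1"
  define f where "f p = gap_mean p (N - p)" for p
  define c where "c i = return_prob i * return_prob (m - i)" for i
  have ends: "f 0 = N" "f N = N"
    by (simp_all add: f_def gap_mean_boundary gap_mean_sym[of 0])
  have slope: "f (p + 1) - f p = 2 * lead_mean p (2 * m - p)" if "p \<le> 2 * m" for p
    using gap_mean_step[of p "2 * m - p"] that by (simp add: f_def N_def Suc_diff_le)
  have curv: "f (p + 1) - 2 * f p + f (p - 1) = 2 * c (p div 2)" if "1 \<le> p" "p \<le> 2 * m" for p
  proof -
    from that have "p - 1 \<le> 2 * m" "p - 1 + 1 = p" by auto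
    with slope[of "p - 1"] have "f p - f (p - 1) = 2 * lead_mean (p - 1) (2 * m - (p - 1))" by metis
    with slope[OF that(2)] lead_mean_diff[OF that] show ?thesis
      unfolding c_def by linarith
  qed
  define X where "X = (\<Sum>p=1..2 * m. real p * (N - real p) * c (p div 2))"
  define S where "S = (\<Sum>p\<le>N. f p)"
  have "2 * X = (\<Sum>p=1..2 * m. real p * (N - real p) * (2 * c (p div 2)))"
    by (simp add: X_def sum_distrib_left mult_ac)
  also have "\<dots> = (\<Sum>p=1..2 * m. real p * (N - real p) * (f (p + 1) - 2 * f p + f (p - 1)))"
    using curv by (intro sum.cong) auto
  also have "\<dots> = - 2 * (\<Sum>p=1..2 * m. f p) + 2 * m * f 0 + 2 * m * f N"
    by (subst sum_second_difference) (simp add: N_def)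
  also have "(\<Sum>p=1..2 * m. f p) = S - f 0 - f N"
    by (simp add: N_def S_def sum.atMost_shift atLeast0AtMost[symmetric] sum.atLeast_Suc_atMost)
  finally have "S = N * (N + 1) - X"
    unfolding ends by (simp add: N_def algebra_simps)
  also have "X = (\<Sum>p=1..2 * m. real p * (N - real p) * c (p div 2))" by (fact X_def)
  also have "(\<Sum>p=1..2 * m. real p * (N - real p) * c (p div 2)) = (\<Sum>p\<le>2 * m + 1. real p * (N - real p) * c (p div 2))"
    by (simp add: N_def sum.atMost_shift atLeast0AtMost[symmetric] sum.atLeast_Suc_atMost)
  also have "\<dots> = (\<Sum>i\<le>m. 8 * (real i * real (m - i) * c i) + 2 * real m * c i)"
    unfolding sum_even_odd by (intro sum.cong) (auto simp: N_def of_nat_diff algebra_simps)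
  also have "\<dots> = 8 * (\<Sum>i\<le>m. real i * real (m - i) * c i) + 2 * real m * (\<Sum>i\<le>m. c i)"
    by (simp only: sum.distrib sum_distrib_left)
  also have "\<dots> = real m * (real m + 1)"
    unfolding sum_return_prob_moments(2)[of m, folded c_def] sum_return_prob[of m, folded c_def]
    by (simp add: field_simps)
  finally show ?thesis by (simp add: S_def f_def N_def algebra_simps)
qed

section \<open>Averages over lists of signs\<close>

definition signs :: "nat \<Rightarrow> int list set" where
  "signs n = {xs. length xs = n \<and> set xs \<subseteq> {1, - 1}}"

lemma signs_0 [simp]: "signs 0 = {[]}"
  by (auto simp: signs_def)

lemma signs_Suc: "signs (Suc n) = (#) 1 ` signs n \<union> (#) (- 1) ` signs n"
  by (auto simp: signs_def length_Suc_conv image_iff)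

lemma finite_signs [simp]: "finite (signs n)"
  by (induction n) (auto simp: signs_Suc)

lemma sum_signs_Suc:
  fixes F :: "int list \<Rightarrow> real"
  shows "(\<Sum>xs\<in>signs (Suc n). F xs) = (\<Sum>xs\<in>signs n. F (1 # xs) + F (- 1 # xs))"
proof -
  have "(\<Sum>xs\<in>signs (Suc n). F xs) = (\<Sum>xs\<in>(#) 1 ` signs n. F xs) + (\<Sum>xs\<in>(#) (- 1) ` signs n. F xs)"
    unfolding signs_Suc by (rule sum.union_disjoint) auto
  then show ?thesis by (simp add: sum.reindex sum.distrib)
qed

lemma sum_signs_append:
  fixes F :: "int list \<Rightarrow> real"
  shows "(\<Sum>xs\<in>signs (p + q). F xs) = (\<Sum>us\<in>signs p. \<Sum>vs\<in>signs q. F (us @ vs))"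
  by (induction p arbitrary: F) (simp_all add: sum_signs_Suc sum.distrib)

lemma sum_signs_middle:
  fixes F :: "int list \<Rightarrow> real"
  shows "(\<Sum>xs\<in>signs (p + Suc q). F xs)
    = (\<Sum>us\<in>signs p. \<Sum>vs\<in>signs q. F (us @ 1 # vs) + F (us @ - 1 # vs))"
  by (simp only: sum_signs_append sum_signs_Suc)

lemma sum_signs_eq_walk_mean:
  "(\<Sum>xs\<in>signs n. f (sum_list xs)) = 2 ^ n * walk_mean n f"
proof (induction n arbitrary: f)
  case (Suc n)
  have "(\<Sum>xs\<in>signs (Suc n). f (sum_list xs))
      = (\<Sum>xs\<in>signs n. 2 * ((f (sum_list xs + 1) + f (sum_list xs - 1)) / 2))"
    unfolding sum_signs_Suc by (intro sum.cong) (auto simp: algebra_simps)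
  also have "\<dots> = 2 ^ Suc n * walk_mean (Suc n) f"
    using Suc[of "\<lambda>x. (f (x + 1) + f (x - 1)) / 2"] by (simp only: sum_distrib_left[symmetric]) simp
  finally show ?case .
qed simp

lemma card_signs: "real (card (signs n)) = 2 ^ n"
  using sum_signs_eq_walk_mean[of "\<lambda>_. 1" n] by (simp add: walk_mean_const)

lemma sum_signs_pair_eq_walk_mean:
  "(\<Sum>us\<in>signs p. \<Sum>vs\<in>signs q. f (sum_list us) (sum_list vs))
    = 2 ^ (p + q) * walk_mean p (\<lambda>x. walk_mean q (f x))"
  by (simp add: sum_signs_eq_walk_mean sum_distrib_left[symmetric] power_add
      sum_signs_eq_walk_mean[of "\<lambda>x. walk_mean q (f x)"])

lemma walk_mean_minus:
  "walk_mean p (\<lambda>x. walk_mean q (\<lambda>y. f (x - y))) = walk_mean (p + q) f"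
  unfolding walk_mean_plus
  by (subst (2) walk_mean_uminus[symmetric]) simp

text \<open>Start a walk with these steps at minus half of their total, so that it ends at the negative of its
start: then this is the sum of the two end points of step \<open>i\<close>.\<close>

definition mid :: "int list \<Rightarrow> nat \<Rightarrow> int" where
  "mid xs i = sum_list (take i xs) - sum_list (drop (Suc i) xs)"

lemma sum_mid:
  assumes "i \<le> 2 * n"
  shows "(\<Sum>xs\<in>signs (2 * n + 1). f (mid xs i)) = 2 ^ (2 * n + 1) * walk_mean (2 * n) f"
proof -
  define k where "k = 2 * n - i"
  have n: "2 * n + 1 = i + Suc k" "i + k = 2 * n" using assms by (auto simp: k_def)
  have "(\<Sum>xs\<in>signs (2 * n + 1). f (mid xs i))
      = (\<Sum>us\<in>signs i. \<Sum>vs\<in>signs k. 2 * f (sum_list us - sum_list vs))"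
    unfolding n(1) sum_signs_middle by (intro sum.cong refl) (simp add: mid_def signs_def)
  also have "\<dots> = 2 * (2 ^ (i + k) * walk_mean i (\<lambda>x. walk_mean k (\<lambda>y. f (x - y))))"
    unfolding sum_distrib_left[symmetric] by (subst sum_signs_pair_eq_walk_mean) simp
  finally show ?thesis unfolding walk_mean_minus n(2) by simp
qed

lemma even_sum_signs: "xs \<in> signs n \<Longrightarrow> even (sum_list xs) \<longleftrightarrow> even n"
  by (induction n arbitrary: xs) (auto simp: signs_Suc)

text \<open>Let \<open>D\<close> be the sum of the signs before \<open>i\<close> minus the sum of those after \<open>j\<close>, and \<open>M\<close> the sum of those
between. The two factors are \<open>\<bar>D - M - e'\<bar>\<close> and \<open>\<bar>D + M + e\<bar>\<close> with the signs \<open>e\<close>, \<open>e'\<close> at \<open>i\<close> and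
\<open>j\<close>. As \<open>D \<plusminus> M\<close> is odd, averaging over \<open>e\<close> and \<open>e'\<close> just deletes them, and \<open>\<bar>D - M\<bar> \<bar>D + M\<bar>\<close>
is \<open>\<bar>D\<^sup>2 - M\<^sup>2\<bar>\<close> for independent walks \<open>D\<close> and \<open>M\<close>.\<close>

lemma sum_mid_mid_less:
  assumes "i < j" "j \<le> 2 * n"
  shows "(\<Sum>xs\<in>signs (2 * n + 1). of_int (\<bar>mid xs i\<bar> * \<bar>mid xs j\<bar>))
    = 2 ^ (2 * n + 1) * gap_mean (j - i - 1) (2 * n - (j - i))"
proof -
  define d where "d = j - i - 1"
  define k where "k = 2 * n - j"
  have n: "2 * n + 1 = i + Suc (d + Suc k)" and ik: "i + k = 2 * n - (j - i)" and j: "j = i + Suc d"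
    using assms by (auto simp: d_def k_def)
  have odd: "odd (i + d + k)" using n by presburger
  have kink: "\<bar>x + 1\<bar> + \<bar>x - 1\<bar> = 2 * \<bar>x\<bar>" if "odd x" for x :: int
    using that by (cases "x = 0") auto
  have inner: "(\<Sum>e\<in>{1, - 1}. \<Sum>e'\<in>{1, - 1}.
        \<bar>mid (us @ e # ms @ e' # ws) i\<bar> * \<bar>mid (us @ e # ms @ e' # ws) j\<bar>)
      = 4 * \<bar>(sum_list ms)\<^sup>2 - (sum_list us - sum_list ws)\<^sup>2\<bar>"
    if "us \<in> signs i" "ms \<in> signs d" "ws \<in> signs k" for us ms ws
  proof -
    define D where "D = sum_list us - sum_list ws"
    define M where "M = sum_list ms"
    have "odd (D - M)" "odd (D + M)"
      using odd that even_sum_signs by (auto simp: D_def M_def)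
    have m: "mid (us @ e # ms @ e' # ws) i = D - M - e'" "mid (us @ e # ms @ e' # ws) j = D + M + e" for e e'
      using that by (simp_all add: mid_def signs_def j D_def M_def)
    have "(\<Sum>e\<in>{1, - 1}. \<Sum>e'\<in>{1, - 1}.
        \<bar>mid (us @ e # ms @ e' # ws) i\<bar> * \<bar>mid (us @ e # ms @ e' # ws) j\<bar>)
      = (\<bar>(D - M) + 1\<bar> + \<bar>(D - M) - 1\<bar>) * (\<bar>(D + M) + 1\<bar> + \<bar>(D + M) - 1\<bar>)"
      unfolding m by (simp add: algebra_simps)
    also have "\<dots> = 4 * \<bar>(D - M) * (D + M)\<bar>"
      unfolding kink[OF \<open>odd (D - M)\<close>] kink[OF \<open>odd (D + M)\<close>] by (simp add: abs_mult)
    also have "(D - M) * (D + M) = D\<^sup>2 - M\<^sup>2" by (simp add: power2_eq_square algebra_simps)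
    finally show ?thesis by (simp add: D_def M_def abs_minus_commute)
  qed
  define F where "F xs = real_of_int (\<bar>mid xs i\<bar> * \<bar>mid xs j\<bar>)" for xs
  have "(\<Sum>xs\<in>signs (2 * n + 1). F xs)
      = (\<Sum>us\<in>signs i. \<Sum>ms\<in>signs d. \<Sum>ws\<in>signs k. \<Sum>e\<in>{1, - 1}. \<Sum>e'\<in>{1, - 1}. F (us @ e # ms @ e' # ws))"
    unfolding n sum_signs_middle
    by (simp add: sum_signs_middle[of "\<lambda>vs. F (_ @ _ # vs)"] sum.distrib ac_simps)
  also have "\<dots> = (\<Sum>us\<in>signs i. \<Sum>ms\<in>signs d. \<Sum>ws\<in>signs k.
      4 * real_of_int \<bar>(sum_list ms)\<^sup>2 - (sum_list us - sum_list ws)\<^sup>2\<bar>)"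
  proof (intro sum.cong refl)
    fix us ms ws assume "us \<in> signs i" "ms \<in> signs d" "ws \<in> signs k"
    from arg_cong[OF inner[OF this], of real_of_int]
    show "(\<Sum>e\<in>{1, - 1}. \<Sum>e'\<in>{1, - 1}. F (us @ e # ms @ e' # ws))
        = 4 * real_of_int \<bar>(sum_list ms)\<^sup>2 - (sum_list us - sum_list ws)\<^sup>2\<bar>"
      unfolding F_def of_int_sum by (simp only: of_int_mult of_int_numeral)
  qed
  also have "\<dots> = (\<Sum>ms\<in>signs d. \<Sum>us\<in>signs i. \<Sum>ws\<in>signs k.
      4 * real_of_int \<bar>(sum_list ms)\<^sup>2 - (sum_list us - sum_list ws)\<^sup>2\<bar>)"
    by (rule sum.swap)
  also have "\<dots> = 4 * (\<Sum>ms\<in>signs d. 2 ^ (i + k) * walk_mean i (\<lambda>x. walk_mean k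
      (\<lambda>y. real_of_int \<bar>(sum_list ms)\<^sup>2 - (x - y)\<^sup>2\<bar>)))"
    unfolding sum_distrib_left[symmetric]
    by (subst sum_signs_pair_eq_walk_mean[where f = "\<lambda>x y. real_of_int \<bar>(sum_list _)\<^sup>2 - (x - y)\<^sup>2\<bar>"])
      (simp only: sum_distrib_left[symmetric])
  also have "\<dots> = 4 * (2 ^ (i + k) * (\<Sum>ms\<in>signs d. walk_mean (i + k)
      (\<lambda>y. real_of_int \<bar>(sum_list ms)\<^sup>2 - y\<^sup>2\<bar>)))"
    by (simp only: walk_mean_minus[where f = "\<lambda>y. real_of_int \<bar>_ - y\<^sup>2\<bar>"])
      (simp only: sum_distrib_left[symmetric])
  also have "\<dots> = 4 * (2 ^ (i + k) * (2 ^ d * gap_mean d (i + k)))"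
    unfolding gap_mean_def
    by (subst sum_signs_eq_walk_mean[where f = "\<lambda>x. walk_mean (i + k) (\<lambda>y. real_of_int \<bar>x\<^sup>2 - y\<^sup>2\<bar>)"]) (rule refl)
  also have "\<dots> = 2 ^ (i + Suc (d + Suc k)) * gap_mean d (i + k)"
    by (simp add: power_add)
  finally show ?thesis by (simp only: F_def n d_def[symmetric] ik[symmetric])
qed

text \<open>By the symmetry of \<open>gap_mean\<close>, the positions after \<open>i\<close> contribute its values for
\<open>d < 2n - i\<close> and the positions before \<open>i\<close> those for \<open>d \<ge> 2n - i\<close>, so that every row has the same
total.\<close>

lemma sum_mid_row:
  assumes "0 < n" "i \<le> 2 * n"
  shows "(\<Sum>j\<le>2 * n. \<Sum>xs\<in>signs (2 * n + 1). of_int (\<bar>mid xs i\<bar> * \<bar>mid xs j\<bar>))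
    = 2 ^ (2 * n + 1) * (real n * (3 * real n + 1))"
proof -
  define g where "g d = gap_mean d (2 * n - 1 - d)" for d
  define G where "G j = (\<Sum>xs\<in>signs (2 * n + 1). real_of_int (\<bar>mid xs i\<bar> * \<bar>mid xs j\<bar>))" for j
  define P where "P = (2 :: real) ^ (2 * n + 1)"
  obtain m where m: "n = Suc m" using assms(1) by (cases n) auto
  have after: "G j = P * g (j - i - 1)" if "i < j" "j \<le> 2 * n" for j
  proof -
    have "2 * n - (j - i) = 2 * n - 1 - (j - i - 1)" using that by auto
    with sum_mid_mid_less[OF that] show ?thesis by (simp add: G_def P_def g_def)
  qed
  have before: "G j = P * g (2 * n - 1 - (i - j - 1))" if "j < i" for j
  proof -
    have "G j = (\<Sum>xs\<in>signs (2 * n + 1). real_of_int (\<bar>mid xs j\<bar> * \<bar>mid xs i\<bar>))"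
      unfolding G_def by (simp only: mult.commute)
    also have "\<dots> = P * gap_mean (i - j - 1) (2 * n - (i - j))"
      using sum_mid_mid_less[OF that assms(2)] by (simp add: P_def)
    also have "gap_mean (i - j - 1) (2 * n - (i - j)) = g (2 * n - 1 - (i - j - 1))"
    proof -
      have "2 * n - 1 - (i - j - 1) = 2 * n - (i - j)" "2 * n - 1 - (2 * n - (i - j)) = i - j - 1"
        using that assms by auto
      then show ?thesis by (simp only: g_def gap_mean_sym[of "i - j - 1"])
    qed
    finally show ?thesis .
  qed
  have "G i = (\<Sum>xs\<in>signs (2 * n + 1). real_of_int ((mid xs i)\<^sup>2))"
    unfolding G_def by (simp add: power2_eq_square abs_mult[symmetric])
  also have "\<dots> = P * (2 * n)"
    using sum_mid[OF assms(2), of "\<lambda>x. real_of_int (x\<^sup>2)"] walk_mean_square[of "2 * n"] by (simp add: P_def)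
  finally have diag: "G i = P * (2 * n)" .
  have "(\<Sum>j\<le>2 * n. G j) = (\<Sum>j<i. G j) + G i + (\<Sum>j\<in>{i<..2 * n}. G j)"
  proof -
    have "{..2 * n} = insert i ({..<i} \<union> {i<..2 * n})" "{..<i} \<inter> {i<..2 * n} = {}"
      using assms by auto
    then show ?thesis by (simp add: sum.union_disjoint)
  qed
  also have "(\<Sum>j<i. G j) = (\<Sum>d\<in>{2 * n - i..<2 * n}. P * g d)"
    using assms before
    by (intro sum.reindex_bij_witness[of _ "\<lambda>d. d - (2 * n - i)" "\<lambda>j. 2 * n - 1 - (i - j - 1)"]) auto
  also have "(\<Sum>j\<in>{i<..2 * n}. G j) = (\<Sum>d<2 * n - i. P * g d)"
    using assms after
    by (intro sum.reindex_bij_witness[of _ "\<lambda>d. d + i + 1" "\<lambda>j. j - i - 1"]) auto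
  also have "(\<Sum>d\<in>{2 * n - i..<2 * n}. P * g d) + G i + (\<Sum>d<2 * n - i. P * g d)
      = (\<Sum>d<2 * n. P * g d) + G i"
  proof -
    have "{..<2 * n} = {2 * n - i..<2 * n} \<union> {..<2 * n - i}" using assms by auto
    moreover have "{2 * n - i..<2 * n} \<inter> {..<2 * n - i} = {}" by auto
    ultimately show ?thesis by (simp add: sum.union_disjoint)
  qed
  also have "(\<Sum>d<2 * n. P * g d) = P * (\<Sum>d\<le>2 * m + 1. gap_mean d (2 * m + 1 - d))"
  proof -
    have "{..<2 * n} = {..2 * m + 1}" "2 * n - 1 = 2 * m + 1" using m by auto
    then show ?thesis by (simp only: g_def sum_distrib_left)
  qed
  also have "\<dots> + G i = P * ((real m + 1) * (3 * real m + 2)) + P * (2 * n)"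
    by (simp only: sum_gap_mean diag)
  also have "\<dots> = P * (real n * (3 * real n + 1))"
    by (simp add: m algebra_simps)
  finally show ?thesis by (simp only: G_def P_def)
qed

text \<open>The size of the core that belongs to a sign list with negative sum. The expression does not change
if all signs are reversed, so lists with positive sum may be included in the average.\<close>

definition size_form :: "nat \<Rightarrow> int list \<Rightarrow> real" where
  "size_form n xs = (real n + 1) / 8 * (\<Sum>i\<le>2 * n. of_int ((mid xs i)\<^sup>2))
    - (\<Sum>i\<le>2 * n. of_int \<bar>mid xs i\<bar>)\<^sup>2 / 32
    - (\<Sum>i\<le>2 * n. of_int \<bar>mid xs i\<bar> * (real i - real n)) / 4
    + (2 * real n + 3) / 16 * (of_int ((sum_list xs)\<^sup>2) - 1)"

text \<open>The mean of \<open>\<bar>mid xs i\<bar>\<close> does not depend on \<open>i\<close>, hence the term with the antisymmetric weight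
\<open>i - n\<close> vanishes.\<close>

lemma sum_size_form:
  assumes "0 < n"
  shows "(\<Sum>xs\<in>signs (2 * n + 1). size_form n xs)
    = 2 ^ (2 * n + 1) * (1 / 32 * (10 * real n ^ 3 + 27 * real n ^ 2 + 19 * real n))"
proof -
  define P where "P = (2 :: real) ^ (2 * n + 1)"
  let ?S = "signs (2 * n + 1)"
  have squares: "(\<Sum>xs\<in>?S. \<Sum>i\<le>2 * n. of_int ((mid xs i)\<^sup>2)) = P * ((2 * real n + 1) * (2 * real n))"
  proof -
    have "(\<Sum>xs\<in>?S. of_int ((mid xs i)\<^sup>2)) = P * (2 * real n)" if "i \<le> 2 * n" for i
      using sum_mid[OF that, of "\<lambda>x. real_of_int (x\<^sup>2)"] walk_mean_square[of "2 * n"] by (simp add: P_def)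
    then show ?thesis by (subst sum.swap) simp
  qed
  have products: "(\<Sum>xs\<in>?S. (\<Sum>i\<le>2 * n. of_int \<bar>mid xs i\<bar>)\<^sup>2)
      = P * ((2 * real n + 1) * (real n * (3 * real n + 1)))"
  proof -
    have "(\<Sum>xs\<in>?S. (\<Sum>i\<le>2 * n. real_of_int \<bar>mid xs i\<bar>)\<^sup>2)
        = (\<Sum>xs\<in>?S. \<Sum>i\<le>2 * n. \<Sum>j\<le>2 * n. real_of_int (\<bar>mid xs i\<bar> * \<bar>mid xs j\<bar>))"
      unfolding power2_eq_square sum_product by simp
    also have "\<dots> = (\<Sum>i\<le>2 * n. \<Sum>xs\<in>?S. \<Sum>j\<le>2 * n. real_of_int (\<bar>mid xs i\<bar> * \<bar>mid xs j\<bar>))"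
      by (rule sum.swap)
    also have "\<dots> = (\<Sum>i\<le>2 * n. P * (real n * (3 * real n + 1)))"
    proof (intro sum.cong refl)
      fix i assume "i \<in> {..2 * n}"
      then have "i \<le> 2 * n" by simp
      from sum_mid_row[OF assms this]
      show "(\<Sum>xs\<in>?S. \<Sum>j\<le>2 * n. real_of_int (\<bar>mid xs i\<bar> * \<bar>mid xs j\<bar>)) = P * (real n * (3 * real n + 1))"
        unfolding P_def by (subst sum.swap) 
    qed
    finally show ?thesis by simp
  qed
  have skew: "(\<Sum>xs\<in>?S. \<Sum>i\<le>2 * n. of_int \<bar>mid xs i\<bar> * (real i - real n)) = 0"
  proof -
    have "(\<Sum>xs\<in>?S. \<Sum>i\<le>2 * n. of_int \<bar>mid xs i\<bar> * (real i - real n))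
        = (\<Sum>i\<le>2 * n. (\<Sum>xs\<in>?S. of_int \<bar>mid xs i\<bar>) * (real i - real n))"
      by (subst sum.swap) (simp only: sum_distrib_right)
    also have "\<dots> = (\<Sum>i\<le>2 * n. P * walk_mean (2 * n) (\<lambda>x. of_int \<bar>x\<bar>) * (real i - real n))"
      using sum_mid[of _ n "\<lambda>x. of_int \<bar>x\<bar>"] by (intro sum.cong) (auto simp: P_def)
    also have "\<dots> = P * walk_mean (2 * n) (\<lambda>x. of_int \<bar>x\<bar>) * (\<Sum>i\<le>2 * n. real i - real n)"
      by (simp only: sum_distrib_left)
    also have "(\<Sum>i\<le>2 * n. real i - real n) = 0"
    proof -
      have "(\<Sum>i\<le>k. real i) = real k * (real k + 1) / 2" for k
        by (induction k) (auto simp: field_simps)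
      from this[of "2 * n"] show ?thesis by (simp add: sum_subtractf)
    qed
    finally show ?thesis by simp
  qed
  have total: "(\<Sum>xs\<in>?S. of_int ((sum_list xs)\<^sup>2) - 1) = P * (2 * real n)"
    using sum_signs_eq_walk_mean[of "\<lambda>x. real_of_int (x\<^sup>2)" "2 * n + 1"] walk_mean_square[of "2 * n + 1"]
      card_signs[of "2 * n + 1"]
    by (simp add: sum_subtractf P_def algebra_simps)
  have "(\<Sum>xs\<in>?S. size_form n xs)
      = (real n + 1) / 8 * (\<Sum>xs\<in>?S. \<Sum>i\<le>2 * n. of_int ((mid xs i)\<^sup>2))
        - (\<Sum>xs\<in>?S. (\<Sum>i\<le>2 * n. of_int \<bar>mid xs i\<bar>)\<^sup>2) / 32
        - (\<Sum>xs\<in>?S. \<Sum>i\<le>2 * n. of_int \<bar>mid xs i\<bar> * (real i - real n)) / 4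
        + (2 * real n + 3) / 16 * (\<Sum>xs\<in>?S. of_int ((sum_list xs)\<^sup>2) - 1)"
    unfolding size_form_def sum.distrib sum_subtractf sum_divide_distrib[symmetric] sum_distrib_left[symmetric]
    by (rule refl)
  also have "\<dots> = P * (1 / 32 * (10 * real n ^ 3 + 27 * real n ^ 2 + 19 * real n))"
    unfolding squares products skew total by (simp add: field_simps power3_eq_cube power2_eq_square)
  finally show ?thesis by (simp add: P_def)
qed

lemma sum_list_map_uminus: "sum_list (map uminus ys) = - sum_list ys" for ys :: "int list"
  by (induction ys) auto

lemma mid_uminus: "mid (map uminus xs) i = - mid xs i"
  by (simp add: mid_def take_map drop_map sum_list_map_uminus)

lemma sum_signs_negative:
  fixes F :: "int list \<Rightarrow> real"
  assumes "\<And>xs. F (map uminus xs) = F xs" "odd n"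
  shows "(\<Sum>xs | xs \<in> signs n \<and> sum_list xs < 0. F xs) = (\<Sum>xs\<in>signs n. F xs) / 2"
proof -
  have "(\<Sum>xs | xs \<in> signs n \<and> sum_list xs < 0. F xs) = (\<Sum>xs | xs \<in> signs n \<and> sum_list xs > 0. F xs)"
    using sum_list_map_uminus assms(1)
    by (intro sum.reindex_bij_witness[of _ "map uminus" "map uminus"])
       (auto simp: signs_def comp_def)
  moreover have "(\<Sum>xs\<in>signs n. F xs) = (\<Sum>xs | xs \<in> signs n \<and> sum_list xs < 0. F xs)
      + (\<Sum>xs | xs \<in> signs n \<and> sum_list xs > 0. F xs)"
  proof -
    have "signs n = {xs \<in> signs n. sum_list xs < 0} \<union> {xs \<in> signs n. sum_list xs > 0}"
      using even_sum_signs[of _ n] assms(2) by (auto, metis even_zero linorder_cases)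
    then show ?thesis by (subst sum.union_disjoint[symmetric]) auto
  qed
  ultimately show ?thesis by simp
qed

section \<open>Sign lists and outlines\<close>

text \<open>A list of \<open>2n+1\<close> signs with sum \<open>-2a - 1\<close> is read as a walk from \<open>a\<close> to \<open>-a - 1\<close>. Folding the
negative half-line onto the other one by \<open>w \<mapsto> -w - 1\<close> turns a crossing into a pair of adjacent
columns of height \<open>0\<close> and every other step into a step of size one.\<close>

definition diag :: "int list \<Rightarrow> int" where
  "diag xs = (- 1 - sum_list xs) div 2"

definition walk :: "int list \<Rightarrow> nat \<Rightarrow> int" where
  "walk xs i = diag xs + sum_list (take i xs)"

definition height :: "int list \<Rightarrow> nat \<Rightarrow> int" where
  "height xs i = (if 0 \<le> walk xs i then walk xs i else - walk xs i - 1)"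

lemma sum_list_take_Suc: "i < length xs \<Longrightarrow> sum_list (take (Suc i) xs) = sum_list (take i xs) + xs ! i"
  for xs :: "int list"
  by (simp add: take_Suc_conv_app_nth)

lemma abs_sum_signs_le: "ys \<in> signs k \<Longrightarrow> \<bar>sum_list ys\<bar> \<le> int k"
proof (induction k arbitrary: ys)
  case (Suc k)
  then obtain e zs where "ys = e # zs" "zs \<in> signs k" "\<bar>e\<bar> = 1" by (auto simp: signs_Suc)
  with Suc.IH[of zs] show ?case by simp
qed simp

context
  fixes n :: nat and xs :: "int list"
  assumes xs: "xs \<in> signs (2 * n + 1)" "sum_list xs < 0"
begin

lemma sum_eq_diag: "sum_list xs = - 2 * diag xs - 1"
proof -
  have "odd (sum_list xs)" using even_sum_signs[OF xs(1)] by simp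
  then show ?thesis unfolding diag_def by presburger
qed

lemma walk_ends: "walk xs 0 = diag xs" "walk xs (2 * n + 1) = - diag xs - 1"
  using xs sum_eq_diag by (simp_all add: walk_def signs_def)

lemma walk_step: "i \<le> 2 * n \<Longrightarrow> \<bar>walk xs (Suc i) - walk xs i\<bar> = 1"
proof -
  assume "i \<le> 2 * n"
  with xs(1) have "i < length xs" "set xs \<subseteq> {1, - 1}" by (auto simp: signs_def)
  then have "i < length xs" "xs ! i \<in> {1, - 1}" using nth_mem by blast+
  then show ?thesis by (auto simp: walk_def sum_list_take_Suc)
qed

lemma profile_height: "profile n (diag xs) (height xs)"
proof -
  have "0 \<le> diag xs" "diag xs \<le> int n"
    using sum_eq_diag xs(2) abs_sum_signs_le[OF xs(1)] by linarith+
  moreover have "height xs 0 = diag xs" "height xs (2 * n + 1) = diag xs"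
    using walk_ends calculation(1) unfolding height_def by auto
  moreover have "\<bar>height xs (Suc i) - height xs i\<bar> = 1 \<or> height xs i = 0 \<and> height xs (Suc i) = 0"
    if "i \<le> 2 * n" for i
    using walk_step[OF that] unfolding height_def by (auto split: if_splits)
  ultimately show ?thesis by (auto simp: profile_def height_def)
qed

lemma even_walk: "i \<le> 2 * n + 1 \<Longrightarrow> even (walk xs i - diag xs - int i)"
proof (induction i)
  case 0
  then show ?case by (simp add: walk_ends)
next
  case (Suc i)
  from walk_step[of i] Suc.prems have "walk xs (Suc i) = walk xs i + 1 \<or> walk xs (Suc i) = walk xs i - 1"
    by linarith
  with Suc show ?case by auto
qed

text \<open>The side of the axis is visible from the parity of the height, so folding loses nothing.\<close>

lemma walk_eq_height:
  assumes "i \<le> 2 * n + 1"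
  shows "walk xs i = (if even (height xs i - diag xs - int i) then height xs i else - height xs i - 1)"
  using even_walk[OF assms] unfolding height_def by auto

lemma mid_eq_height:
  assumes "i \<le> 2 * n"
  shows "\<bar>mid xs i\<bar> = 2 * max (height xs i) (height xs (Suc i))"
proof -
  have len: "i < length xs" using assms xs(1) by (simp add: signs_def)
  have "sum_list xs = sum_list (take (Suc i) xs) + sum_list (drop (Suc i) xs)"
    by (metis append_take_drop_id sum_list_append)
  then have "mid xs i = walk xs i + walk xs (Suc i) + 1"
    using sum_eq_diag by (simp add: mid_def walk_def)
  with walk_step[OF assms] show ?thesis unfolding height_def max_def by (auto split: if_splits)
qed

lemma size_form_eq:
  "size_form n xs = real (\<Sum>(below n (diag xs) (height xs)))
    - real (card (below n (diag xs) (height xs))) * (real (card (below n (diag xs) (height xs))) - 1) / 2"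
proof -
  define M where "M i = real_of_int (max (height xs i) (height xs (Suc i)))" for i
  have mid: "real_of_int \<bar>mid xs i\<bar> = 2 * M i" "real_of_int ((mid xs i)\<^sup>2) = 4 * (M i)\<^sup>2" if "i \<le> 2 * n" for i
  proof -
    show *: "real_of_int \<bar>mid xs i\<bar> = 2 * M i"
      using mid_eq_height[OF that] by (simp add: M_def)
    have "real_of_int ((mid xs i)\<^sup>2) = (real_of_int \<bar>mid xs i\<bar>)\<^sup>2" by simp
    also have "\<dots> = 4 * (M i)\<^sup>2" unfolding * by (simp add: power2_eq_square)
    finally show "real_of_int ((mid xs i)\<^sup>2) = 4 * (M i)\<^sup>2" .
  qed
  have "size_form n xs = (real n + 1) / 8 * (\<Sum>i\<le>2 * n. 4 * (M i)\<^sup>2) - (\<Sum>i\<le>2 * n. 2 * M i)\<^sup>2 / 32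
      - (\<Sum>i\<le>2 * n. 2 * (M i * (real i - real n))) / 4 + (2 * real n + 3) / 16 * (of_int ((sum_list xs)\<^sup>2) - 1)"
    unfolding size_form_def using mid by (intro arg_cong2[where f = plus] arg_cong2[where f = minus]) (auto simp: mult.assoc)
  also have "\<dots> = (real n + 1) / 2 * (\<Sum>i\<le>2 * n. (M i)\<^sup>2) - (\<Sum>i\<le>2 * n. M i)\<^sup>2 / 8
      - (\<Sum>i\<le>2 * n. M i * (real i - real n)) / 2 + (2 * real n + 3) / 4 * of_int (diag xs * (diag xs + 1))"
    unfolding sum_distrib_left[symmetric] sum_eq_diag by (simp add: power2_eq_square field_simps)
  finally show ?thesis unfolding size_below[OF profile_height] by (simp add: M_def)
qed

end

lemma below_cong:
  assumes "\<And>i. i \<le> 2 * n + 1 \<Longrightarrow> b i = b' i"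
  shows "below n a b = below n a b'"
  unfolding below_def using assms by (intro Collect_cong) metis

text \<open>For surjectivity, a profile is unfolded by the parity of its heights. The last column has the
wrong parity, since \<open>2n+1\<close> is odd, so the unfolded walk ends at \<open>-a - 1\<close> and the sum of its steps
is negative.\<close>

lemma bij_betw_signs_bead_sets:
  "bij_betw (\<lambda>xs. below n (diag xs) (height xs)) {xs. xs \<in> signs (2 * n + 1) \<and> sum_list xs < 0}
     {B. bead_set n B}"
proof (rule bij_betwI')
  fix xs ys assume "xs \<in> {xs. xs \<in> signs (2 * n + 1) \<and> sum_list xs < 0}"
    "ys \<in> {xs. xs \<in> signs (2 * n + 1) \<and> sum_list xs < 0}"
  then have xs: "xs \<in> signs (2 * n + 1)" "sum_list xs < 0" and ys: "ys \<in> signs (2 * n + 1)" "sum_list ys < 0" by auto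
  show "(below n (diag xs) (height xs) = below n (diag ys) (height ys)) = (xs = ys)"
  proof
    assume eq: "below n (diag xs) (height xs) = below n (diag ys) (height ys)"
    from below_inject[OF profile_height[OF xs] profile_height[OF ys] this]
    have lev: "diag xs = diag ys" and h: "\<And>i. i \<le> 2 * n + 1 \<Longrightarrow> height xs i = height ys i" by auto
    have pos: "walk xs i = walk ys i" if "i \<le> 2 * n + 1" for i
      unfolding walk_eq_height[OF xs that] walk_eq_height[OF ys that] lev h[OF that] ..
    show "xs = ys"
    proof (rule nth_equalityI)
      show "length xs = length ys" using xs ys by (simp add: signs_def)
    next
      fix i assume i: "i < length xs"
      then have "i \<le> 2 * n + 1" "Suc i \<le> 2 * n + 1" "i < length ys" using xs ys by (auto simp: signs_def)
      with pos[of i] pos[of "Suc i"] lev i show "xs ! i = ys ! i"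
        by (simp add: walk_def sum_list_take_Suc)
    qed
  qed simp
next
  fix xs assume "xs \<in> {xs. xs \<in> signs (2 * n + 1) \<and> sum_list xs < 0}"
  then show "below n (diag xs) (height xs) \<in> {B. bead_set n B}"
    using bead_set_below[OF profile_height] by blast
next
  fix B assume "B \<in> {B. bead_set n B}"
  then obtain a b where p: "profile n a b" and B: "below n a b = B" using ex_profile by blast
  note bounds = profile_bounds[OF p]
  define W where "W i = (if even (b i - a - int i) then b i else - b i - 1)" for i
  define xs where "xs = map (\<lambda>i. W (Suc i) - W i) [0..<2 * n + 1]"
  have W0: "W 0 = a" and WL: "W (2 * n + 1) = - a - 1" unfolding W_def bounds(3,4) by simp_all
  have nth_xs: "length xs = 2 * n + 1" "i \<le> 2 * n \<Longrightarrow> xs ! i = W (Suc i) - W i" for i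
    by (simp_all add: xs_def del: upt_Suc)
  have take: "sum_list (take k xs) = W k - a" if "k \<le> 2 * n + 1" for k
    using that
  proof (induction k)
    case (Suc k)
    then show ?case using sum_list_take_Suc[of k xs] by (simp add: nth_xs)
  qed (simp add: W0)
  have sum: "sum_list xs = - 2 * a - 1"
    using take[of "2 * n + 1"] WL by (simp add: xs_def)
  have W_step: "W (Suc i) - W i \<in> {1, - 1}" if i: "i \<le> 2 * n" for i
  proof -
    consider "b (Suc i) = b i + 1" | "b (Suc i) = b i - 1" | "b i = 0" "b (Suc i) = 0"
      using profile_step[OF p i] by linarith
    then show ?thesis by cases (auto simp: W_def)
  qed
  have "set xs \<subseteq> {1, - 1}"
  proof
    fix e assume "e \<in> set xs"
    then obtain i where "i \<le> 2 * n" "e = W (Suc i) - W i"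
      by (auto simp: xs_def less_Suc_eq_le simp del: upt_Suc)
    with W_step show "e \<in> {1, - 1}" by simp
  qed
  then have xs: "xs \<in> signs (2 * n + 1)" "sum_list xs < 0"
    using sum bounds(1) by (auto simp: signs_def xs_def)
  have lev: "diag xs = a" by (simp add: diag_def sum)
  have "height xs i = b i" if "i \<le> 2 * n + 1" for i
    using take[OF that] bounds(5)[OF that] by (auto simp: height_def walk_def lev W_def)
  then have "below n (diag xs) (height xs) = B"
    using B below_cong[of n "height xs" b a] lev by simp
  with xs show "\<exists>xs\<in>{xs. xs \<in> signs (2 * n + 1) \<and> sum_list xs < 0}. B = below n (diag xs) (height xs)"
    by blast
qed

lemma bij_betw_cores_bead_sets:
  "bij_betw beads (distinct_cores (2 * n + 1) (2 * n + 3)) {B. bead_set n B}"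
proof -
  have cores: "p \<in> distinct_cores (2 * n + 1) (2 * n + 3) \<longleftrightarrow> is_partition p \<and> bead_set n (beads p)" for p
    using distinct_iff_beads[of p] zero_notin_beads[of p]
    unfolding distinct_cores_def bead_set_def by (auto simp: is_core_iff_beads)
  show ?thesis
  proof (rule bij_betwI')
    fix B assume "B \<in> {B. bead_set n B}"
    then have "bead_set n B" by simp
    moreover from this obtain p where "is_partition p" "beads p = B"
      using ex_partition_beads[of B] by (auto simp: bead_set_def)
    ultimately show "\<exists>p\<in>distinct_cores (2 * n + 1) (2 * n + 3). B = beads p" using cores by blast
  qed (use cores beads_inject in auto)
qed

section \<open>The average size\<close>

theorem theorem1:
  fixes n :: nat
  assumes "n > 0"
  shows "average_size (distinct_cores (2 * n + 1) (2 * n + 3))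
    = 1 / 32 * (10 * real n ^ 3 + 27 * real n ^ 2 + 19 * real n)"
proof -
  define D where "D = distinct_cores (2 * n + 1) (2 * n + 3)"
  define X where "X = {xs. xs \<in> signs (2 * n + 1) \<and> sum_list xs < 0}"
  define size where "size B = real (\<Sum>B) - real (card B) * (real (card B) - 1) / 2" for B
  have size_beads: "size (beads p) = real (sum_list p)" if "p \<in> D" for p
  proof -
    have p: "is_partition p" using that by (simp add: D_def distinct_cores_def is_core_def)
    from arg_cong[OF sum_beads[OF p], of real_of_int] show ?thesis
      by (simp add: size_def card_beads[OF p] field_simps)
  qed
  have "(\<Sum>p\<in>D. real (sum_list p)) = (\<Sum>p\<in>D. size (beads p))"
    using size_beads by simp
  also have "\<dots> = (\<Sum>B | bead_set n B. size B)"
    unfolding D_def by (rule sum.reindex_bij_betw[OF bij_betw_cores_bead_sets])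
  also have "\<dots> = (\<Sum>xs\<in>X. size (below n (diag xs) (height xs)))"
    unfolding X_def by (rule sum.reindex_bij_betw[OF bij_betw_signs_bead_sets, symmetric])
  also have "\<dots> = (\<Sum>xs\<in>X. size_form n xs)"
    using size_form_eq[of _ n] by (intro sum.cong) (auto simp: X_def size_def)
  also have "\<dots> = (\<Sum>xs\<in>signs (2 * n + 1). size_form n xs) / 2"
    unfolding X_def
  proof (rule sum_signs_negative)
    fix xs :: "int list"
    show "size_form n (map uminus xs) = size_form n xs"
      by (simp add: size_form_def mid_uminus sum_list_map_uminus)
  qed simp
  also have "\<dots> = 4 ^ n * (1 / 32 * (10 * real n ^ 3 + 27 * real n ^ 2 + 19 * real n))"
    unfolding sum_size_form[OF assms] by (simp add: power_mult)
  finally have total: "(\<Sum>p\<in>D. real (sum_list p)) = 4 ^ n * (1 / 32 * (10 * real n ^ 3 + 27 * real n ^ 2 + 19 * real n))" .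
  have "card D = card X"
    using bij_betw_same_card[OF bij_betw_cores_bead_sets] bij_betw_same_card[OF bij_betw_signs_bead_sets]
    by (simp add: D_def X_def)
  also have "real (card X) = (\<Sum>xs\<in>X. 1)" by simp
  also have "\<dots> = (\<Sum>xs\<in>signs (2 * n + 1). 1) / 2"
    unfolding X_def by (rule sum_signs_negative) simp_all
  also have "\<dots> = 4 ^ n" using card_signs[of "2 * n + 1"] by (simp add: power_mult)
  finally show ?thesis using total by (simp add: average_size_def D_def)
qed

end
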